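(* Let $K\subset\mathbb{R}^3$ be a polygonal knot with $n$ vertices. Let $\mathcal{S}$ be the set of all round 2-spheres and planes $S$ such that, for some pair of non-adjacent edges $[\mathbf{w},\mathbf{x}]$ and $[\mathbf{y},\mathbf{z}]$ of $K$, $S$ is the unique round 2-sphere or plane containing the four vertices $\mathbf{w},\mathbf{x},\mathbf{y},\mathbf{z}$. Then the number of distinct knot types that arise as $\hat\rho[\mathbf{p},r](K)$, over all $r>0$ and all $\mathbf{p}\in\mathbb{R}^3\setminus\{\text{vertices of }K\}$ for which $\hat\rho[\mathbf{p},r](K)$ is an embedded polygon, is at most the number of connected components of $\mathbb{R}^3\setminus\bigcup_{S\in\mathcal{S}}S$. Moreover, $\mathcal{S}$ has at most $n(n-3)/2$ elements.
   Context: A polygonal knot with $n$ vertices (equivalently $n$ edges) is a simple closed polygon in $\mathbb{R}^3$ with a cyclically ordered list of vertices $v_1,\dots,v_n$ and edges the segments $[v_i,v_{i+1}]$ (indices mod $n$). Two distinct edges are non-adjacent if they share no vertex. Knot type means ambient isotopy class of (unoriented) knots in $\mathbb{R}^3$; mirror images are distinguished. For $\mathbf{p}\in\mathbb{R}^3$, $r>0$, inversion in the sphere of radius $r$ centered at $\mathbf{p}$ is the map $\rho[\mathbf{p},r](\mathbf{x})=\mathbf{p}+\frac{r^2(\mathbf{x}-\mathbf{p})}{|\mathbf{x}-\mathbf{p}|^2}$ on $\mathbb{R}^3\setminus\{\mathbf{p}\}$. Polygonal inversion: if no vertex of $K$ equals $\mathbf{p}$, then $\hat\rho[\mathbf{p},r](K)$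 is the closed polygon with successive vertices $\rho[\mathbf{p},r](v_1),\dots,\rho[\mathbf{p},r](v_n)$ connected by straight line segments. It may be self-intersecting; it has a knot type only when it is embedded. A four-tuple of vertices lying on a common circle or line (so that it is not contained in a unique member of the family of all round spheres and planes) contributes nothing to $\mathcal{S}$. *)

theory Defs
  imports "HOL-Analysis.Analysis" "HOL-Library.Equipollence"
begin

text \<open>A closed polygon is given by the cyclic list of its vertices;
  edge \<open>i\<close> joins vertex \<open>i\<close> to its cyclic successor.\<close>

definition edge_ends :: "(real^3) list \<Rightarrow> nat \<Rightarrow> (real^3) set" where
  "edge_ends vs i = {vs ! i, vs ! (Suc i mod length vs)}"

definition edge :: "(real^3) list \<Rightarrow> nat \<Rightarrow> (real^3) set" where
  "edge vs i = closed_segment (vs ! i) (vs ! (Suc i mod length vs))"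

definition polygon :: "(real^3) list \<Rightarrow> (real^3) set" where
  "polygon vs = (\<Union>i<length vs. edge vs i)"

text \<open>Embedded (simple) closed polygon: two distinct edges meet only in the vertices they have
  in common. Straight angles at a vertex are allowed.\<close>

definition embedded_polygon :: "(real^3) list \<Rightarrow> bool" where
  "embedded_polygon vs \<longleftrightarrow> 3 \<le> length vs \<and> distinct vs \<and>
    (\<forall>i<length vs. \<forall>j<length vs. i \<noteq> j \<longrightarrow>
       edge vs i \<inter> edge vs j = edge_ends vs i \<inter> edge_ends vs j)"

definition nonadjacent :: "(real^3) list \<Rightarrow> nat \<Rightarrow> nat \<Rightarrow> bool" where
  "nonadjacent vs i j \<longleftrightarrow> edge_ends vs i \<inter> edge_ends vs j = {}"

text \<open>The path of homeomorphisms of space starts at the identity, so mirror images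
  are distinguished; only the images of the curves matter, so orientation is ignored.\<close>

definition ambient_isotopic :: "(real^3) set \<Rightarrow> (real^3) set \<Rightarrow> bool" where
  "ambient_isotopic A B \<longleftrightarrow>
    (\<exists>h. homotopic_with (homeomorphic_map euclidean euclidean) euclidean euclidean id h \<and> h ` A = B)"

text \<open>The ambient isotopy class. No restriction to knots is needed: every set
  ambient isotopic to a knot is again a knot.\<close>

definition knot_type :: "(real^3) set \<Rightarrow> (real^3) set set" where
  "knot_type A = {B. ambient_isotopic A B}"

text \<open>Only used away from the centre \<open>p\<close>; the formula gives the value \<open>p\<close> there.\<close>

definition inversion :: "real^3 \<Rightarrow> real \<Rightarrow> real^3 \<Rightarrow> real^3" where
  "inversion p r x = p + (r\<^sup>2 / (norm (x - p))\<^sup>2) *\<^sub>R (x - p)"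

definition polygonal_inversion :: "real^3 \<Rightarrow> real \<Rightarrow> (real^3) list \<Rightarrow> (real^3) list" where
  "polygonal_inversion p r vs = map (inversion p r) vs"

definition spheres_and_planes :: "(real^3) set set" where
  "spheres_and_planes = {sphere c r | c r. 0 < r} \<union> {{x. a \<bullet> x = b} | a b. a \<noteq> 0}"

text \<open>The spheres and planes uniquely determined by the four endpoints of two nonadjacent edges.
  Concyclic or collinear four-tuples fail uniqueness and contribute nothing.\<close>

definition edge_pair_spheres :: "(real^3) list \<Rightarrow> (real^3) set set" where
  "edge_pair_spheres vs = {S \<in> spheres_and_planes. \<exists>i<length vs. \<exists>j<length vs. nonadjacent vs i j \<and>
     edge_ends vs i \<union> edge_ends vs j \<subseteq> S \<and>
     (\<forall>T\<in>spheres_and_planes. edge_ends vs i \<union> edge_ends vs j \<subseteq> T \<longrightarrow> T = S)}"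

definition inversion_knot_types :: "(real^3) list \<Rightarrow> (real^3) set set set" where
  "inversion_knot_types vs =
     {knot_type (polygon (polygonal_inversion p r vs)) | p r.
        0 < r \<and> p \<notin> set vs \<and> embedded_polygon (polygonal_inversion p r vs)}"

end

theory Submission
  imports Defs
begin

text \<open>
  A small displacement of the vertices of an embedded polygon extends to a perturbation of the
  identity of space with Lipschitz constant below 1 (an embedded polygon has bounded chord-arc
  distortion, and Lipschitz functions extend), so the knot type of an embedded polygon is stable.
  Lifting \<open>v\<close> to \<open>(1, v, v \<bullet> v)\<close> turns spheres and planes into linear hyperplanes. If two edges of
  the inverted polygon cross, the lift of the centre \<open>p\<close> is a linear combination of the lifts of the
  four vertices involved; hence \<open>p\<close> lies either on the unique sphere or plane through them, or on a
  circle or line through three vertices. The latter are finitely many sets of codimension 2, which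
  any two points outside of them can avoid by moving in a triangle in general position. So the knot
  type is constant on the part of each component where \<open>p\<close> is generic, and every knot type that
  occurs already occurs at a generic \<open>p\<close>.
\<close>

text \<open>Avoiding the members of \<open>edge_pair_spheres K\<close> does not by itself make the
  inverted polygon embedded. A four-tuple on a common circle contributes no sphere, yet its edges
  may cross after inversion when the centre lies on that circle; adjacent edges may overlap when the
  centre lies on the circle through their three ends. So a component can contain centres without a
  knot type, and constancy has to be proved around them. Conversely, a centre on a member of
  \<open>edge_pair_spheres K\<close> may well give an embedded polygon. Stability is therefore used
  twice: along paths of generic centres, and to push an arbitrary centre to a generic one. The count
  is an injection that sends each knot type to the component of one chosen generic centre. The
  radius only rescales the picture about the centre, so it can be set to 1.\<close>

section \<open>Ambient isotopy as an equivalence relation\<close>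

lemma homeomorphic_map_sym:
  assumes "homeomorphic_map X Y h"
  obtains k where "homeomorphic_map Y X k" "homeomorphic_maps X Y h k"
  using assms homeomorphic_map_maps homeomorphic_maps_sym by metis

lemma ambient_isotopic_sym:
  assumes "ambient_isotopic A B"
  shows "ambient_isotopic B A"
proof -
  let ?P = "homeomorphic_map euclidean euclidean :: (real^3 \<Rightarrow> real^3) \<Rightarrow> bool"
  obtain h where h: "homotopic_with ?P euclidean euclidean id h" and hA: "h ` A = B"
    using assms by (auto simp: ambient_isotopic_def)
  have "?P h"
    using h homotopic_with_imp_property by blast
  then obtain k where k: "?P k" and hk: "homeomorphic_maps euclidean euclidean h k"
    by (rule homeomorphic_map_sym)
  then have kh: "k (h x) = x" "h (k x) = x" for x
    by (auto simp: homeomorphic_maps_def)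
  \<comment> \<open>Precomposed with the inverse \<open>k\<close> of \<open>h\<close>, the isotopy
    runs from \<open>k\<close> to the identity; reversed, it is an isotopy for
    \<open>k\<close>.\<close>
  have "homotopic_with ?P euclidean euclidean (id \<circ> k) (h \<circ> k)"
    by (rule homotopic_with_compose_continuous_map_right[OF h homeomorphic_imp_continuous_map[OF k]])
       (rule homeomorphic_map_compose[OF k])
  moreover have "h \<circ> k = id" using kh by auto
  ultimately have "homotopic_with ?P euclidean euclidean id k"
    by (simp add: homotopic_with_sym)
  moreover have "k ` B = A" unfolding hA[symmetric] by (simp add: image_image kh)
  ultimately show ?thesis by (auto simp: ambient_isotopic_def)
qed

lemma ambient_isotopic_trans:
  assumes "ambient_isotopic A B" "ambient_isotopic B C"
  shows "ambient_isotopic A C"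
proof -
  let ?P = "homeomorphic_map euclidean euclidean :: (real^3 \<Rightarrow> real^3) \<Rightarrow> bool"
  obtain h where h: "homotopic_with ?P euclidean euclidean id h" and hA: "h ` A = B"
    using assms by (auto simp: ambient_isotopic_def)
  obtain k where k: "homotopic_with ?P euclidean euclidean id k" and kB: "k ` B = C"
    using assms by (auto simp: ambient_isotopic_def)
  have Ph: "?P h"
    using h homotopic_with_imp_property by blast
  have "homotopic_with ?P euclidean euclidean (id \<circ> h) (k \<circ> h)"
    by (rule homotopic_with_compose_continuous_map_right[OF k homeomorphic_imp_continuous_map[OF Ph]])
       (rule homeomorphic_map_compose[OF Ph])
  then have "homotopic_with ?P euclidean euclidean id (k \<circ> h)"
    using h homotopic_with_trans by fastforce
  moreover have "(k \<circ> h) ` A = C" unfolding hA[symmetric] kB[symmetric] by (rule image_comp[symmetric])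
  ultimately show ?thesis by (auto simp: ambient_isotopic_def)
qed

lemma ambient_isotopic_refl: "ambient_isotopic A A"
proof -
  have "homotopic_with (homeomorphic_map euclidean euclidean) euclidean euclidean id (id :: real^3 \<Rightarrow> real^3)"
    by simp
  then show ?thesis
    unfolding ambient_isotopic_def by (intro exI[of _ id]) simp
qed

lemma knot_type_eq_iff: "knot_type A = knot_type B \<longleftrightarrow> ambient_isotopic A B"
  using ambient_isotopic_refl ambient_isotopic_sym ambient_isotopic_trans
  unfolding knot_type_def by blast

section \<open>Perturbations of the identity and extension of Lipschitz maps\<close>

text \<open>Solving \<open>x + g x = y\<close> means finding a fixed point of the contraction
  \<open>\<lambda>x. y - g x\<close>, so Banach's theorem gives surjectivity. Distances shrink at
  most by the factor \<open>1 - c\<close>, which gives injectivity and a Lipschitz inverse.\<close>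

lemma homeomorphic_map_id_plus_contraction:
  fixes g :: "'a::banach \<Rightarrow> 'a"
  assumes g: "c-lipschitz_on UNIV g" and "c < 1"
  shows "homeomorphic_map euclidean euclidean (\<lambda>x. x + g x)"
proof -
  have c0: "0 \<le> c" using g lipschitz_on_nonneg by blast
  have exp: "(1 - c) * dist x y \<le> dist (x + g x) (y + g y)" for x y
  proof -
    have "dist x y \<le> dist (x + g x) (y + g y) + dist (g x) (g y)"
      unfolding dist_norm using norm_triangle_ineq4[of "x + g x - (y + g y)" "g x - g y"]
      by (simp add: algebra_simps)
    then show ?thesis
      using lipschitz_onD[OF g, of x y] by (simp add: algebra_simps)
  qed
  have "\<exists>x. y = x + g x" for y
  proof -
    have "\<exists>!x. y - g x = x"
      by (rule banach_fix_type[OF c0 \<open>c < 1\<close>])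
         (use lipschitz_onD[OF g] in \<open>auto simp: dist_norm norm_minus_commute\<close>)
    then show ?thesis by (metis diff_add_cancel)
  qed
  then obtain k where k: "\<And>y. k y + g (k y) = y" by metis
  have kx: "k (x + g x) = x" for x
    using exp[of "k (x + g x)" x] \<open>c < 1\<close> by (auto simp: k mult_le_0_iff)
  have "(1 / (1 - c))-lipschitz_on UNIV k"
    using exp[of "k _" "k _"] \<open>c < 1\<close> by (intro lipschitz_onI) (auto simp: k field_simps)
  then have "continuous_on UNIV k" by (rule lipschitz_on_continuous_on)
  moreover have "continuous_on UNIV (\<lambda>x. x + g x)"
    using lipschitz_on_continuous_on[OF g] by (intro continuous_intros)
  ultimately have "homeomorphic_maps euclidean euclidean (\<lambda>x. x + g x) k"
    by (simp add: homeomorphic_maps_def k kx)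
  then show ?thesis using homeomorphic_map_maps by blast
qed

text \<open>Each point moves along the segment from \<open>x\<close> to \<open>x + g x\<close>. The
  homeomorphism condition is left as a hypothesis because homotheties are to be covered too, and
  their displacement need not be contracting.\<close>

lemma ambient_isotopic_straight_line:
  fixes g :: "real^3 \<Rightarrow> real^3"
  assumes cont: "continuous_on UNIV g"
    and homeo: "\<And>t. 0 \<le> t \<Longrightarrow> t \<le> 1 \<Longrightarrow> homeomorphic_map euclidean euclidean (\<lambda>x. x + t *\<^sub>R g x)"
  shows "ambient_isotopic A ((\<lambda>x. x + g x) ` A)"
proof -
  define H where "H = (\<lambda>z::real \<times> (real^3). snd z + fst z *\<^sub>R g (snd z))"
  have "continuous_on UNIV H"
    unfolding H_def by (intro continuous_intros continuous_on_compose2[OF cont]) auto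
  then have "continuous_on ({0..1} \<times> UNIV) H"
    using continuous_on_subset by blast
  then have "continuous_map (prod_topology (top_of_set {0..1}) euclidean) euclidean H"
    using prod_topology_subtopology_eu[of "{0..1::real}" "UNIV :: (real^3) set"] by simp
  then have "homotopic_with (homeomorphic_map euclidean euclidean) euclidean euclidean id (\<lambda>x. x + g x)"
    unfolding homotopic_with_def by (intro exI[of _ H]) (use homeo in \<open>auto simp: H_def\<close>)
  then show ?thesis
    unfolding ambient_isotopic_def by blast
qed

lemma ambient_isotopic_lipschitz_perturbation:
  fixes g :: "real^3 \<Rightarrow> real^3"
  assumes g: "c-lipschitz_on UNIV g" and "c < 1"
  shows "ambient_isotopic A ((\<lambda>x. x + g x) ` A)"
proof (rule ambient_isotopic_straight_line)
  show "continuous_on UNIV g"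
    using g by (rule lipschitz_on_continuous_on)
  fix t :: real assume t: "0 \<le> t" "t \<le> 1"
  have "(\<bar>t\<bar> * c)-lipschitz_on UNIV (\<lambda>x. t *\<^sub>R g x)"
    using lipschitz_on_cmult[OF g] by simp
  moreover have "\<bar>t\<bar> * c < 1"
    using t \<open>c < 1\<close> mult_left_le_one_le[of c t] lipschitz_on_nonneg[OF g] by simp
  ultimately show "homeomorphic_map euclidean euclidean (\<lambda>x. x + t *\<^sub>R g x)"
    by (rule homeomorphic_map_id_plus_contraction)
qed

text \<open>McShane's extension theorem, for a function on the image of \<open>y\<close> given as an indexed family;
  the bound makes it single valued.\<close>

lemma lipschitz_extension_real:
  fixes y :: "'i \<Rightarrow> 'a::metric_space" and d :: "'i \<Rightarrow> real"
  assumes "0 \<le> L" and lip: "\<And>a b. a \<in> I \<Longrightarrow> b \<in> I \<Longrightarrow> \<bar>d a - d b\<bar> \<le> L * dist (y a) (y b)"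
  shows "\<exists>F. L-lipschitz_on UNIV F \<and> (\<forall>a\<in>I. F (y a) = d a)"
proof (cases "I = {}")
  case True
  have "L-lipschitz_on UNIV (\<lambda>_::'a. 0::real)"
    using \<open>0 \<le> L\<close> by (intro lipschitz_onI) auto
  with True show ?thesis by auto
next
  case False
  define F where "F x = (INF a\<in>I. d a + L * dist x (y a))" for x
  \<comment> \<open>This bounds the infimum from below and, at \<open>x = y b\<close>, gives the
    lower half of \<open>F (y b) = d b\<close>.\<close>
  have bound: "d b - L * dist x (y b) \<le> d a + L * dist x (y a)" if "a \<in> I" "b \<in> I" for a b x
  proof -
    have "d b - d a \<le> L * dist (y a) (y b)" using lip[OF that] by linarith
    also have "\<dots> \<le> L * (dist x (y a) + dist x (y b))"
      using \<open>0 \<le> L\<close> dist_triangle3[of "y a" "y b" x] by (intro mult_left_mono) auto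
    finally show ?thesis by (simp add: algebra_simps)
  qed
  have bdd: "bdd_below ((\<lambda>a. d a + L * dist x (y a)) ` I)" for x
    using bound False by (meson bdd_belowI2 ex_in_conv)
  have le: "F x \<le> F z + L * dist x z" for x z
  proof -
    have "F x - L * dist x z \<le> F z"
      unfolding F_def[of z]
    proof (rule cINF_greatest[OF False])
      fix a assume "a \<in> I"
      then have "F x \<le> d a + L * dist x (y a)"
        unfolding F_def by (rule cINF_lower[OF bdd])
      also have "\<dots> \<le> d a + L * (dist x z + dist z (y a))"
        using \<open>0 \<le> L\<close> dist_triangle by (intro add_left_mono mult_left_mono) auto
      finally show "F x - L * dist x z \<le> d a + L * dist z (y a)"
        by (simp add: algebra_simps)
    qed
    then show ?thesis by simp
  qed
  have "L-lipschitz_on UNIV F"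
  proof (rule lipschitz_onI)
    fix x z show "dist (F x) (F z) \<le> L * dist x z"
      using le[of x z] le[of z x] by (simp add: dist_real_def dist_commute abs_le_iff)
  qed fact
  moreover have "F (y b) = d b" if "b \<in> I" for b
  proof (rule antisym)
    show "F (y b) \<le> d b"
      using cINF_lower[OF bdd that, of "y b"] by (simp add: F_def)
    show "d b \<le> F (y b)"
      unfolding F_def using bound[OF _ that, of _ "y b"] by (intro cINF_greatest[OF False]) auto
  qed
  ultimately show ?thesis by blast
qed

text \<open>The scalar extension is applied in each coordinate; bounding the norm by the sum of the
  coordinates costs the factor \<open>DIM('b)\<close>. The loss is harmless, since the vertices may
  be displaced as little as desired.\<close>

lemma lipschitz_extension:
  fixes y :: "'i \<Rightarrow> 'a::metric_space" and d :: "'i \<Rightarrow> 'b::euclidean_space"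
  assumes "0 \<le> L" and lip: "\<And>a b. a \<in> I \<Longrightarrow> b \<in> I \<Longrightarrow> dist (d a) (d b) \<le> L * dist (y a) (y b)"
  shows "\<exists>F. (real DIM('b) * L)-lipschitz_on UNIV F \<and> (\<forall>a\<in>I. F (y a) = d a)"
proof -
  have "\<exists>F. L-lipschitz_on UNIV F \<and> (\<forall>a\<in>I. F (y a) = d a \<bullet> e)" if "e \<in> Basis" for e
  proof (rule lipschitz_extension_real[OF \<open>0 \<le> L\<close>])
    fix a b assume "a \<in> I" "b \<in> I"
    have "\<bar>d a \<bullet> e - d b \<bullet> e\<bar> \<le> dist (d a) (d b)"
      using Basis_le_norm[OF that, of "d a - d b"] by (simp add: dist_norm inner_diff_left)
    with lip[OF \<open>a \<in> I\<close> \<open>b \<in> I\<close>] show "\<bar>d a \<bullet> e - d b \<bullet> e\<bar> \<le> L * dist (y a) (y b)" by simp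
  qed
  then obtain F where F: "\<And>e. e \<in> Basis \<Longrightarrow> L-lipschitz_on UNIV (F e)"
      "\<And>e a. e \<in> Basis \<Longrightarrow> a \<in> I \<Longrightarrow> F e (y a) = d a \<bullet> e"
    by metis
  define G where "G x = (\<Sum>e\<in>Basis. F e x *\<^sub>R e)" for x
  have "(real DIM('b) * L)-lipschitz_on UNIV G"
  proof (rule lipschitz_onI)
    fix x z
    have "dist (G x) (G z) \<le> (\<Sum>e\<in>Basis. \<bar>(G x - G z) \<bullet> e\<bar>)"
      unfolding dist_norm by (rule norm_le_l1)
    also have "\<dots> \<le> (\<Sum>e\<in>(Basis::'b set). L * dist x z)"
    proof (rule sum_mono)
      fix e :: 'b assume "e \<in> Basis"
      then show "\<bar>(G x - G z) \<bullet> e\<bar> \<le> L * dist x z"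
        using lipschitz_onD[OF F(1), of e x z] by (simp add: G_def inner_diff_left dist_real_def)
    qed
    finally show "dist (G x) (G z) \<le> real DIM('b) * L * dist x z" by simp
  qed (use \<open>0 \<le> L\<close> in simp)
  moreover have "G (y a) = d a" if "a \<in> I" for a
    using that by (simp add: G_def F euclidean_representation)
  ultimately show ?thesis by blast
qed

section \<open>Distortion and stability of embedded polygons\<close>

definition segment_point :: "'a::real_vector \<Rightarrow> 'a \<Rightarrow> real \<Rightarrow> 'a" where
  "segment_point a b s = (1 - s) *\<^sub>R a + s *\<^sub>R b"

lemma closed_segment_eq_segment_point: "closed_segment a b = segment_point a b ` {0..1}"
  by (auto simp: closed_segment_def segment_point_def)

lemma segment_point_0 [simp]: "segment_point a b 0 = a"
  by (simp add: segment_point_def)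

lemma norm_segment_point_le:
  fixes a b :: "'a::real_normed_vector"
  assumes "norm a \<le> \<delta>" "norm b \<le> \<delta>" "0 \<le> s" "s \<le> 1"
  shows "norm (segment_point a b s) \<le> \<delta>"
proof -
  have "norm (segment_point a b s) \<le> (1 - s) * norm a + s * norm b"
    unfolding segment_point_def using assms norm_triangle_ineq[of "(1 - s) *\<^sub>R a" "s *\<^sub>R b"] by simp
  also have "\<dots> \<le> \<delta>"
    using assms by (intro convex_bound_le) auto
  finally show ?thesis .
qed

lemma norm_segment_point_diff:
  fixes a b :: "'a::real_normed_vector"
  shows "norm (segment_point a b s - segment_point a b t) = \<bar>s - t\<bar> * norm (b - a)"
proof -
  have "segment_point a b s - segment_point a b t = (s - t) *\<^sub>R (b - a)"
    by (simp add: segment_point_def algebra_simps)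
  then show ?thesis by simp
qed

lemma norm_segment_point_diff_le:
  fixes a b :: "'a::real_normed_vector"
  assumes "norm a \<le> \<delta>" "norm b \<le> \<delta>"
  shows "norm (segment_point a b s - segment_point a b t) \<le> 2 * \<delta> * \<bar>s - t\<bar>"
  unfolding norm_segment_point_diff
  using assms norm_triangle_ineq4[of b a] mult_left_mono[of "norm (b - a)" "2 * \<delta>" "\<bar>s - t\<bar>"]
  by (simp add: mult.commute)

text \<open>By homogeneity one may divide by \<open>s\<close>: what remains is the distance from
  \<open>a\<close> to the point \<open>(t / s) *\<^sub>R b\<close> of a segment that avoids
  \<open>a\<close>, and this is bounded below.\<close>

lemma chord_bound_one_sided:
  fixes a b :: "'a::euclidean_space"
  assumes "a \<notin> closed_segment 0 b"
  shows "\<exists>\<mu>>0. \<forall>s t. 0 \<le> t \<and> t \<le> s \<longrightarrow> \<mu> * s \<le> norm (s *\<^sub>R a - t *\<^sub>R b)"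
proof -
  obtain \<mu> where \<mu>: "0 < \<mu>" "\<And>x. x \<in> closed_segment 0 b \<Longrightarrow> \<mu> \<le> dist a x"
    using separate_point_closed[OF closed_segment assms] by blast
  have "\<mu> * s \<le> norm (s *\<^sub>R a - t *\<^sub>R b)" if "0 \<le> t" "t \<le> s" for s t
  proof (cases "s = 0")
    case False
    with that have s: "0 < s" by simp
    have "(t / s) *\<^sub>R b \<in> closed_segment 0 b"
      unfolding closed_segment_def using that s by (auto intro!: exI[of _ "t / s"])
    then have "s * \<mu> \<le> s * norm (a - (t / s) *\<^sub>R b)"
      using \<mu>(2) s by (simp add: dist_norm)
    also have "\<dots> = norm (s *\<^sub>R (a - (t / s) *\<^sub>R b))" using s by simp
    also have "s *\<^sub>R (a - (t / s) *\<^sub>R b) = s *\<^sub>R a - t *\<^sub>R b"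
      using s by (simp add: scaleR_diff_right)
    finally show ?thesis by (simp add: mult.commute)
  qed simp
  with \<mu>(1) show ?thesis by blast
qed

text \<open>With \<open>v\<close> as origin, \<open>s\<close> and \<open>t\<close> both measure the
  way from the common endpoint, hence the parameter \<open>1 - s\<close>. Neither far end lies on
  the other segment, so the one-sided bound applies to whichever parameter is larger. A straight
  angle is harmless; folding back is what \<open>inter\<close> excludes.\<close>

lemma chord_bound_at_common_endpoint:
  fixes v a b :: "'a::euclidean_space"
  assumes inter: "closed_segment a v \<inter> closed_segment v b = {v}" and "a \<noteq> v" "b \<noteq> v"
  shows "\<exists>\<mu>>0. \<forall>s t. 0 \<le> s \<and> 0 \<le> t \<longrightarrow>
    \<mu> * max s t \<le> norm (segment_point a v (1 - s) - segment_point v b t)"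
proof -
  have shift: "x - v \<notin> closed_segment 0 (z - v)" if "x \<notin> closed_segment v z" for x z :: 'a
    using closed_segment_translation[of "- v" v z] that by (auto simp: image_iff)
  have "a - v \<notin> closed_segment 0 (b - v)"
    by (rule shift) (use inter \<open>a \<noteq> v\<close> ends_in_segment(1)[of a v] in blast)
  then obtain \<mu>1 where \<mu>1: "0 < \<mu>1" "\<And>s t. 0 \<le> t \<Longrightarrow> t \<le> s \<Longrightarrow> \<mu>1 * s \<le> norm (s *\<^sub>R (a - v) - t *\<^sub>R (b - v))"
    using chord_bound_one_sided by blast
  have "b - v \<notin> closed_segment 0 (a - v)"
    by (rule shift) (use inter \<open>b \<noteq> v\<close> ends_in_segment(2)[of b v] closed_segment_commute[of a v] in blast)
  then obtain \<mu>2 where \<mu>2: "0 < \<mu>2" "\<And>s t. 0 \<le> t \<Longrightarrow> t \<le> s \<Longrightarrow> \<mu>2 * s \<le> norm (s *\<^sub>R (b - v) - t *\<^sub>R (a - v))"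
    using chord_bound_one_sided by blast
  have "min \<mu>1 \<mu>2 * max s t \<le> norm (segment_point a v (1 - s) - segment_point v b t)"
    if "0 \<le> s" "0 \<le> t" for s t
  proof -
    have eq: "segment_point a v (1 - s) - segment_point v b t = s *\<^sub>R (a - v) - t *\<^sub>R (b - v)"
      by (simp add: segment_point_def algebra_simps)
    show ?thesis
    proof (cases "t \<le> s")
      case True
      then have "min \<mu>1 \<mu>2 * max s t \<le> \<mu>1 * s" using that by (simp add: mult_right_mono)
      with \<mu>1(2)[OF that(2) True] show ?thesis unfolding eq by linarith
    next
      case False
      then have "min \<mu>1 \<mu>2 * max s t \<le> \<mu>2 * t" using that by (simp add: mult_right_mono max_def)
      moreover have "\<mu>2 * t \<le> norm (s *\<^sub>R (a - v) - t *\<^sub>R (b - v))"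
        using \<mu>2(2)[of s t] that False by (simp add: norm_minus_commute)
      ultimately show ?thesis unfolding eq by linarith
    qed
  qed
  with \<mu>1(1) \<mu>2(1) show ?thesis by (intro exI[of _ "min \<mu>1 \<mu>2"]) auto
qed

text \<open>The vertices form a function so that one formula, linear in \<open>v\<close>, describes
  both the points of a polygon and, for a vertex displacement \<open>e\<close>, the displacements of
  these points.\<close>

definition edge_point :: "(nat \<Rightarrow> 'a::real_vector) \<Rightarrow> nat \<Rightarrow> nat \<Rightarrow> real \<Rightarrow> 'a" where
  "edge_point v n i s = segment_point (v i) (v (Suc i mod n)) s"

lemma edge_eq_edge_point: "edge vs i = edge_point ((!) vs) (length vs) i ` {0..1}"
  by (simp add: edge_def edge_point_def closed_segment_eq_segment_point fun_eq_iff)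

lemma Suc_mod_eq_iff:
  assumes "i < n" "j < n"
  shows "Suc i mod n = Suc j mod n \<longleftrightarrow> i = j"
  using assms by (auto simp: mod_Suc)

lemma edge_ends_disjoint:
  assumes "distinct vs" "i < length vs" "j < length vs" "i \<noteq> j"
    "j \<noteq> Suc i mod length vs" "i \<noteq> Suc j mod length vs"
  shows "edge_ends vs i \<inter> edge_ends vs j = {}"
proof -
  have "Suc i mod length vs < length vs" "Suc j mod length vs < length vs"
    using assms(2) by (auto intro!: mod_less_divisor)
  moreover have "Suc i mod length vs \<noteq> Suc j mod length vs"
    using assms Suc_mod_eq_iff by blast
  ultimately show ?thesis
    using assms by (auto simp: edge_ends_def nth_eq_iff_index_eq)
qed

text \<open>The displacement of the edges by a perturbation of the vertices is Lipschitz with a constant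
  proportional to the size of the perturbation; \<open>M\<close> absorbs the distortion of the polygon.\<close>

lemma edge_displacement_bound:
  fixes vs :: "(real^3) list"
  assumes emb: "embedded_polygon vs" and ij: "i < length vs" "j < length vs"
  shows "\<exists>M\<ge>0. \<forall>e \<delta> s t. (\<forall>k<length vs. norm (e k :: real^3) \<le> \<delta>) \<longrightarrow> s \<in> {0..1} \<longrightarrow> t \<in> {0..1} \<longrightarrow>
    norm (edge_point e (length vs) i s - edge_point e (length vs) j t)
    \<le> M * \<delta> * norm (edge_point ((!) vs) (length vs) i s - edge_point ((!) vs) (length vs) j t)"
    (is "?Q i j")
proof -
  let ?n = "length vs"
  let ?E = "edge_point ((!) vs) ?n"
  let ?s = "\<lambda>i. Suc i mod ?n"
  have n: "3 \<le> ?n" and dist: "distinct vs"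
    and meet: "\<And>i j. i < ?n \<Longrightarrow> j < ?n \<Longrightarrow> i \<noteq> j \<Longrightarrow> edge vs i \<inter> edge vs j = edge_ends vs i \<inter> edge_ends vs j"
    using emb by (auto simp: embedded_polygon_def)
  have s_lt: "?s i < ?n" for i using n by (intro mod_less_divisor) auto
  have s_neq: "?s i \<noteq> i" "?s (?s i) \<noteq> i" if "i < ?n" for i
    using n that by (auto simp: mod_Suc)
  have ext: "vs ! i = vs ! j \<longleftrightarrow> i = j" if "i < ?n" "j < ?n" for i j
    using that dist nth_eq_iff_index_eq by blast
  have sym: "?Q j i" if "?Q i j" for i j
    using that by (metis norm_minus_commute)
  \<comment> \<open>Displacement and chord are both compared with a weight \<open>w s t\<close>, so
    that \<open>M = C / \<mu>\<close>. The weight is \<open>\<bar>s - t\<bar>\<close> on a single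
    edge, the larger parameter distance from the common vertex on adjacent edges, and 1 on disjoint
    edges.\<close>
  have scale: "\<exists>M\<ge>0. \<forall>e \<delta> s t. (\<forall>k<?n. norm (e k :: real^3) \<le> \<delta>) \<longrightarrow> s \<in> {0..1} \<longrightarrow> t \<in> {0..1} \<longrightarrow>
      norm (edge_point e ?n i s - edge_point e ?n j t) \<le> M * \<delta> * norm (?E i s - ?E j t)"
    if "0 < \<mu>" and le: "\<And>e \<delta> s t. (\<forall>k<?n. norm (e k :: real^3) \<le> \<delta>) \<Longrightarrow> 0 \<le> s \<Longrightarrow> s \<le> 1 \<Longrightarrow> 0 \<le> t \<Longrightarrow> t \<le> 1 \<Longrightarrow>
      norm (edge_point e ?n i s - edge_point e ?n j t) \<le> C * \<delta> * w s t"
      and w: "\<And>s t. 0 \<le> s \<Longrightarrow> s \<le> 1 \<Longrightarrow> 0 \<le> t \<Longrightarrow> t \<le> 1 \<Longrightarrow> \<mu> * w s t \<le> norm (?E i s - ?E j t)"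
      and "0 \<le> C"
    for i j \<mu> C and w :: "real \<Rightarrow> real \<Rightarrow> real"
  proof (intro exI[of _ "C / \<mu>"] conjI allI impI)
    fix e \<delta> and s t :: real assume e: "\<forall>k<?n. norm (e k :: real^3) \<le> \<delta>" and st: "s \<in> {0..1}" "t \<in> {0..1}"
    have "0 \<le> \<delta>" using e n norm_ge_zero[of "e 0"] by (metis order_trans less_le_trans zero_less_numeral)
    have "norm (edge_point e ?n i s - edge_point e ?n j t) \<le> C * \<delta> * w s t"
      using e st le by auto
    also have "\<dots> = (C / \<mu> * \<delta>) * (\<mu> * w s t)" using \<open>0 < \<mu>\<close> by simp
    also have "\<dots> \<le> (C / \<mu> * \<delta>) * norm (?E i s - ?E j t)"
      using st w \<open>0 \<le> \<delta>\<close> \<open>0 < \<mu>\<close> \<open>0 \<le> C\<close> by (intro mult_left_mono) auto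
    finally show "norm (edge_point e ?n i s - edge_point e ?n j t) \<le> C / \<mu> * \<delta> * norm (?E i s - ?E j t)" .
  qed (use \<open>0 < \<mu>\<close> \<open>0 \<le> C\<close> in simp)
  have adj: "?Q i (?s i)" if i: "i < ?n" for i
  proof -
    let ?v = "vs ! ?s i" and ?a = "vs ! i" and ?b = "vs ! ?s (?s i)"
    have neq: "?a \<noteq> ?v" "?b \<noteq> ?v" "?a \<noteq> ?b"
      using ext s_lt s_neq i by metis+
    then have "edge_ends vs i \<inter> edge_ends vs (?s i) = {?v}"
      by (auto simp: edge_ends_def)
    then have "closed_segment ?a ?v \<inter> closed_segment ?v ?b = {?v}"
      using meet[OF i s_lt s_neq(1)[OF i, symmetric]] by (simp add: edge_def)
    with neq obtain \<mu> where \<mu>: "0 < \<mu>"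
      "\<And>s t. 0 \<le> s \<Longrightarrow> 0 \<le> t \<Longrightarrow> \<mu> * max s t \<le> norm (segment_point ?a ?v (1 - s) - segment_point ?v ?b t)"
      using chord_bound_at_common_endpoint by metis
    show ?thesis
    proof (rule scale[OF \<mu>(1), where w = "\<lambda>s t. max (1 - s) t" and C = 4])
      fix e \<delta> and s t :: real
      assume e: "\<forall>k<?n. norm (e k :: real^3) \<le> \<delta>" and st: "0 \<le> s" "s \<le> 1" "0 \<le> t" "t \<le> 1"
      have "norm (e i) \<le> \<delta>" using e i by blast
      then have "0 \<le> \<delta>" using norm_ge_zero order_trans by blast
      \<comment> \<open>The displacements agree at the shared vertex, so their difference splits
        there; each half contributes \<open>2 * \<delta>\<close> times a parameter distance, whence
        \<open>C = 4\<close>.\<close>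
      have "edge_point e ?n i 1 = edge_point e ?n (?s i) 0"
        by (simp add: edge_point_def segment_point_def)
      then have "norm (edge_point e ?n i s - edge_point e ?n (?s i) t)
        \<le> norm (edge_point e ?n i s - edge_point e ?n i 1)
          + norm (edge_point e ?n (?s i) 0 - edge_point e ?n (?s i) t)"
        using norm_triangle_ineq[of "edge_point e ?n i s - edge_point e ?n i 1"
            "edge_point e ?n (?s i) 0 - edge_point e ?n (?s i) t"] by simp
      also have "\<dots> \<le> 2 * \<delta> * \<bar>s - 1\<bar> + 2 * \<delta> * \<bar>0 - t\<bar>"
        unfolding edge_point_def using e i s_lt
        by (intro add_mono norm_segment_point_diff_le) auto
      also have "\<dots> \<le> 2 * \<delta> * max (1 - s) t + 2 * \<delta> * max (1 - s) t"
        using st \<open>0 \<le> \<delta>\<close> by (intro add_mono mult_left_mono) auto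
      finally show "norm (edge_point e ?n i s - edge_point e ?n (?s i) t) \<le> 4 * \<delta> * max (1 - s) t"
        by simp
    next
      fix s t :: real
      assume "0 \<le> s" "s \<le> 1" "0 \<le> t" "t \<le> 1"
      then show "\<mu> * max (1 - s) t \<le> norm (?E i s - ?E (?s i) t)"
        using \<mu>(2)[of "1 - s" t] by (simp add: edge_point_def)
    qed simp
  qed
  consider "i = j" | "j = ?s i" | "i = ?s j" | "i \<noteq> j" "j \<noteq> ?s i" "i \<noteq> ?s j" by blast
  then show ?thesis
  proof cases
    case 1
    show ?thesis unfolding 1[symmetric]
    proof (rule scale[where w = "\<lambda>s t. \<bar>s - t\<bar>" and C = 2 and \<mu> = "norm (vs ! ?s i - vs ! i)"])
      show "0 < norm (vs ! ?s i - vs ! i)" using ext s_lt s_neq ij by simp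
      fix e \<delta> and s t :: real
      assume "\<forall>k<?n. norm (e k :: real^3) \<le> \<delta>"
      then show "norm (edge_point e ?n i s - edge_point e ?n i t) \<le> 2 * \<delta> * \<bar>s - t\<bar>"
        unfolding edge_point_def using ij s_lt by (intro norm_segment_point_diff_le) auto
    qed (simp_all add: edge_point_def norm_segment_point_diff mult.commute)
  next
    case 2 then show ?thesis using adj ij by blast
  next
    case 3 then show ?thesis using adj sym ij by blast
  next
    case 4
    then have "edge vs i \<inter> edge vs j = {}"
      using meet edge_ends_disjoint dist ij by auto
    then obtain \<mu> where \<mu>: "0 < \<mu>" "\<And>x y. x \<in> edge vs i \<Longrightarrow> y \<in> edge vs j \<Longrightarrow> \<mu> \<le> dist x y"
      using separate_compact_closed[of "edge vs i" "edge vs j"] by (auto simp: edge_def)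
    show ?thesis
    proof (rule scale[OF \<mu>(1), where w = "\<lambda>_ _. 1" and C = 2])
      fix e \<delta> and s t :: real
      assume "\<forall>k<?n. norm (e k :: real^3) \<le> \<delta>" "0 \<le> s" "s \<le> 1" "0 \<le> t" "t \<le> 1"
      then have "norm (edge_point e ?n i s) \<le> \<delta>" "norm (edge_point e ?n j t) \<le> \<delta>"
        unfolding edge_point_def using ij s_lt by (auto intro!: norm_segment_point_le)
      then show "norm (edge_point e ?n i s - edge_point e ?n j t) \<le> 2 * \<delta> * 1"
        using norm_triangle_ineq4[of "edge_point e ?n i s" "edge_point e ?n j t"] by simp
    next
      fix s t :: real
      assume "0 \<le> s" "s \<le> 1" "0 \<le> t" "t \<le> 1"
      then show "\<mu> * 1 \<le> norm (?E i s - ?E j t)"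
        using \<mu>(2)[of "?E i s" "?E j t"] by (auto simp: edge_eq_edge_point dist_norm)
    qed simp
  qed
qed

lemma polygon_displacement_bound:
  fixes vs :: "(real^3) list"
  assumes emb: "embedded_polygon vs"
  obtains M where "0 < M" "\<And>e \<delta> i j s t. (\<forall>k<length vs. norm (e k :: real^3) \<le> \<delta>) \<Longrightarrow>
    i < length vs \<Longrightarrow> j < length vs \<Longrightarrow> s \<in> {0..1} \<Longrightarrow> t \<in> {0..1} \<Longrightarrow>
    norm (edge_point e (length vs) i s - edge_point e (length vs) j t)
    \<le> M * \<delta> * norm (edge_point ((!) vs) (length vs) i s - edge_point ((!) vs) (length vs) j t)"
proof -
  let ?n = "length vs"
  obtain M where M0: "\<And>i j. i < ?n \<Longrightarrow> j < ?n \<Longrightarrow> 0 \<le> M i j" and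
    M: "\<And>i j e \<delta> s t. i < ?n \<Longrightarrow> j < ?n \<Longrightarrow> (\<forall>k<?n. norm (e k :: real^3) \<le> \<delta>) \<Longrightarrow> s \<in> {0..1} \<Longrightarrow> t \<in> {0..1} \<Longrightarrow>
    norm (edge_point e ?n i s - edge_point e ?n j t)
    \<le> M i j * \<delta> * norm (edge_point ((!) vs) ?n i s - edge_point ((!) vs) ?n j t)"
    using edge_displacement_bound[OF emb] by metis
  \<comment> \<open>The sum dominates every entry, all being nonnegative; the summand 1 makes
    \<open>N\<close> positive, as the bound will be divided by.\<close>
  define N where "N = 1 + (\<Sum>i<?n. \<Sum>j<?n. M i j)"
  have le: "M i j \<le> N" if "i < ?n" "j < ?n" for i j
  proof -
    have "M i j \<le> (\<Sum>j<?n. M i j)" using that M0 by (intro member_le_sum) auto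
    also have "\<dots> \<le> (\<Sum>i<?n. \<Sum>j<?n. M i j)"
      using that M0 by (intro member_le_sum[of i "{..<?n}" "\<lambda>i. \<Sum>j<?n. M i j"]) (auto intro!: sum_nonneg)
    finally show ?thesis by (simp add: N_def)
  qed
  show thesis
  proof
    show "0 < N" unfolding N_def using M0 by (intro add_pos_nonneg sum_nonneg) auto
    fix e \<delta> i j and s t :: real assume e: "\<forall>k<?n. norm (e k :: real^3) \<le> \<delta>" and ij: "i < ?n" "j < ?n"
      and st: "s \<in> {0..1}" "t \<in> {0..1}"
    have "norm (e i) \<le> \<delta>" using e ij by blast
    then have "0 \<le> \<delta>" using norm_ge_zero order_trans by blast
    then have "M i j * \<delta> * norm (edge_point ((!) vs) ?n i s - edge_point ((!) vs) ?n j t)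
      \<le> N * \<delta> * norm (edge_point ((!) vs) ?n i s - edge_point ((!) vs) ?n j t)"
      using le[OF ij] by (intro mult_right_mono) auto
    with M[OF ij e st]
    show "norm (edge_point e ?n i s - edge_point e ?n j t)
      \<le> N * \<delta> * norm (edge_point ((!) vs) ?n i s - edge_point ((!) vs) ?n j t)" by linarith
  qed
qed

text \<open>Injectivity makes images commute with intersections of edges. Two maps will be inserted:
  the perturbation of the identity and the homothety that changes the radius of inversion.\<close>

lemma embedded_polygon_image:
  assumes emb: "embedded_polygon vs" and "inj f" and len: "length ws = length vs"
    and edges: "\<And>i. i < length vs \<Longrightarrow> f ` edge vs i = edge ws i"
    and verts: "\<And>i. i < length vs \<Longrightarrow> f (vs ! i) = ws ! i"
  shows "embedded_polygon ws \<and> f ` polygon vs = polygon ws"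
proof
  have n: "3 \<le> length vs" using emb by (simp add: embedded_polygon_def)
  have ws: "ws = map f vs"
    using len verts by (intro nth_equalityI) auto
  have ends: "edge_ends ws i = f ` edge_ends vs i" if "i < length vs" for i
  proof -
    have "Suc i mod length vs < length vs" using n by (intro mod_less_divisor) auto
    then show ?thesis using that by (simp add: ws edge_ends_def)
  qed
  show "embedded_polygon ws"
    unfolding embedded_polygon_def
  proof (intro conjI allI impI)
    show "3 \<le> length ws" using n len by simp
    show "distinct ws"
      using emb \<open>inj f\<close> by (auto simp: ws distinct_map embedded_polygon_def intro: inj_on_subset)
    fix i j assume ij: "i < length ws" "j < length ws" "i \<noteq> j"
    then have "edge vs i \<inter> edge vs j = edge_ends vs i \<inter> edge_ends vs j"
      using emb len by (auto simp: embedded_polygon_def)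
    then show "edge ws i \<inter> edge ws j = edge_ends ws i \<inter> edge_ends ws j"
      using ij len \<open>inj f\<close> by (simp add: ends edges[symmetric] image_Int[symmetric])
  qed
  show "f ` polygon vs = polygon ws"
    unfolding polygon_def by (simp add: image_UN len edges)
qed

lemma embedded_polygon_stable:
  assumes emb: "embedded_polygon vs"
  shows "\<exists>\<epsilon>>0. \<forall>ws. length ws = length vs \<and> (\<forall>i<length vs. dist (ws ! i) (vs ! i) < \<epsilon>) \<longrightarrow>
    embedded_polygon ws \<and> ambient_isotopic (polygon vs) (polygon ws)"
proof -
  let ?n = "length vs"
  obtain M where M: "0 < M" "\<And>e \<delta> i j s t. (\<forall>k<?n. norm (e k :: real^3) \<le> \<delta>) \<Longrightarrow>
    i < ?n \<Longrightarrow> j < ?n \<Longrightarrow> s \<in> {0..1} \<Longrightarrow> t \<in> {0..1} \<Longrightarrow>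
    norm (edge_point e ?n i s - edge_point e ?n j t)
    \<le> M * \<delta> * norm (edge_point ((!) vs) ?n i s - edge_point ((!) vs) ?n j t)"
    using polygon_displacement_bound[OF emb] by blast
  have n: "3 \<le> ?n" using emb by (simp add: embedded_polygon_def)
  \<comment> \<open>The displacement becomes \<open>1/6\<close>-Lipschitz along the polygon, and its
    coordinatewise extension in dimension 3 has the constant \<open>1/2\<close>.\<close>
  define \<epsilon> where "\<epsilon> = 1 / (6 * M)"
  have "\<epsilon> > 0" using M(1) by (simp add: \<epsilon>_def)
  moreover have "embedded_polygon ws \<and> ambient_isotopic (polygon vs) (polygon ws)"
    if len: "length ws = ?n" and close: "\<forall>i<?n. dist (ws ! i) (vs ! i) < \<epsilon>" for ws
  proof -
    define e where "e k = ws ! k - vs ! k" for k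
    have e: "\<forall>k<?n. norm (e k) \<le> \<epsilon>"
      using close by (auto simp: e_def dist_norm intro: less_imp_le)
    have "\<exists>F. (real DIM(real^3) * (1 / 6))-lipschitz_on UNIV F \<and>
      (\<forall>a\<in>{..<?n} \<times> {0..1}. F (case a of (i, s) \<Rightarrow> edge_point ((!) vs) ?n i s) = (case a of (i, s) \<Rightarrow> edge_point e ?n i s))"
    proof (rule lipschitz_extension, goal_cases)
      case (2 a b)
      then show ?case
        using M(2)[OF e, of "fst a" "fst b" "snd a" "snd b"] M(1)
        by (auto simp: \<epsilon>_def dist_norm)
    qed simp
    then obtain g :: "real^3 \<Rightarrow> real^3" where g: "(1/2)-lipschitz_on UNIV g"
      and gE: "\<And>i s. i < ?n \<Longrightarrow> 0 \<le> s \<Longrightarrow> s \<le> 1 \<Longrightarrow> g (edge_point ((!) vs) ?n i s) = edge_point e ?n i s"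
      by auto
    define f where "f x = x + g x" for x
    have fE: "f (edge_point ((!) vs) ?n i s) = edge_point ((!) ws) ?n i s" if "i < ?n" "0 \<le> s" "s \<le> 1" for i s
      using gE[OF that] by (simp add: f_def e_def edge_point_def segment_point_def algebra_simps)
    have "homeomorphic_map euclidean euclidean f"
      unfolding f_def using g by (rule homeomorphic_map_id_plus_contraction) simp
    then have "inj f" using homeomorphic_imp_injective_map by fastforce
    have "embedded_polygon ws \<and> f ` polygon vs = polygon ws"
    proof (rule embedded_polygon_image[OF emb \<open>inj f\<close> len])
      fix i assume i: "i < ?n"
      show "f ` edge vs i = edge ws i"
        using fE[OF i] by (simp add: edge_eq_edge_point len image_image)
      show "f (vs ! i) = ws ! i"
        using fE[OF i, of 0] by (simp add: edge_point_def)
    qed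
    moreover have "ambient_isotopic (polygon vs) (f ` polygon vs)"
      unfolding f_def using g by (rule ambient_isotopic_lipschitz_perturbation) simp
    ultimately show ?thesis by simp
  qed
  ultimately show ?thesis by blast
qed

section \<open>Spheres, planes and circles as linear algebra\<close>

text \<open>Spheres and planes are the preimages of hyperplanes through the origin under this lift.\<close>

definition paraboloid_lift :: "real^3 \<Rightarrow> real \<times> (real^3) \<times> real" where
  "paraboloid_lift v = (1, v, v \<bullet> v)"

text \<open>This is the circle or line through the three points only if they are distinct.\<close>

definition circle_through :: "real^3 \<Rightarrow> real^3 \<Rightarrow> real^3 \<Rightarrow> (real^3) set" where
  "circle_through a b c = {p. paraboloid_lift p \<in> span {paraboloid_lift a, paraboloid_lift b, paraboloid_lift c}}"

lemma inj_paraboloid_lift: "inj paraboloid_lift"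
  by (auto simp: inj_def paraboloid_lift_def)

lemma in_span_insert3:
  "x \<in> span {a, b, c} \<longleftrightarrow> (\<exists>i j k. x = i *\<^sub>R a + j *\<^sub>R b + k *\<^sub>R c)"
  by (auto simp: span_breakdown_eq algebra_simps)

text \<open>A line meets the paraboloid in at most two points: the first coordinate makes the
  combination affine, and comparing last coordinates leaves \<open>i * (1 - i)\<close> times the
  squared distance of \<open>b\<close> and \<open>c\<close>, whose vanishing forces \<open>a\<close>
  to be \<open>b\<close> or \<open>c\<close>.\<close>

lemma paraboloid_lift_notin_span:
  assumes "a \<noteq> b" "a \<noteq> c"
  shows "paraboloid_lift a \<notin> span {paraboloid_lift b, paraboloid_lift c}"
proof
  assume "paraboloid_lift a \<in> span {paraboloid_lift b, paraboloid_lift c}"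
  then obtain i j where "paraboloid_lift a = i *\<^sub>R paraboloid_lift b + j *\<^sub>R paraboloid_lift c"
    by (auto simp: span_breakdown_eq algebra_simps)
  then have ij: "j = 1 - i" and a: "a = i *\<^sub>R b + j *\<^sub>R c" and sq: "a \<bullet> a = i * (b \<bullet> b) + j * (c \<bullet> c)"
    by (auto simp: paraboloid_lift_def)
  have "(i * (1 - i)) * ((b - c) \<bullet> (b - c)) = 0"
    using sq unfolding a ij by (simp add: algebra_simps inner_commute power2_eq_square)
  then have "i = 0 \<or> i = 1 \<or> b = c" by simp
  with assms a ij show False by (auto simp flip: scaleR_add_left)
qed

text \<open>No line contains three points of the paraboloid, so even collinear points have
  independent lifts. This is why lines and circles can be treated alike.\<close>

lemma independent_paraboloid_lift:
  assumes "distinct [a, b, c]"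
  shows "independent {paraboloid_lift a, paraboloid_lift b, paraboloid_lift c}"
    and "card {paraboloid_lift a, paraboloid_lift b, paraboloid_lift c} = 3"
proof -
  have "paraboloid_lift b \<notin> span {paraboloid_lift c}"
    using paraboloid_lift_notin_span[of b c c] assms by simp
  moreover have "paraboloid_lift c \<noteq> 0"
    by (simp add: paraboloid_lift_def zero_prod_def)
  ultimately show "independent {paraboloid_lift a, paraboloid_lift b, paraboloid_lift c}"
    using paraboloid_lift_notin_span[of a b c] assms
    by (simp add: independent_insert inj_eq[OF inj_paraboloid_lift])
  show "card {paraboloid_lift a, paraboloid_lift b, paraboloid_lift c} = 3"
    using assms by (simp add: inj_eq[OF inj_paraboloid_lift])
qed

text \<open>Three independent vectors in a space of dimension at most three fill it.
  \<open>x\<close>, \<open>y\<close>, \<open>z\<close> are arbitrary vectors because a tangent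
  vector of the paraboloid will be inserted.\<close>

lemma span_subset_span_paraboloid_lift:
  assumes "distinct [a, b, c]"
    and "{paraboloid_lift a, paraboloid_lift b, paraboloid_lift c} \<subseteq> span {x, y, z}"
  shows "span {x, y, z} \<subseteq> span {paraboloid_lift a, paraboloid_lift b, paraboloid_lift c}"
proof (rule card_ge_dim_independent)
  have "dim (span {x, y, z}) \<le> card {x, y, z}"
    by (simp add: dim_le_card span_superset)
  also have "\<dots> \<le> 3"
    using card_insert_le_m1[of 3 "{y, z}" x] card_insert_le_m1[of 2 "{z}" y] by simp
  finally show "dim (span {x, y, z}) \<le> card {paraboloid_lift a, paraboloid_lift b, paraboloid_lift c}"
    using independent_paraboloid_lift[OF assms(1)] by simp
qed (use assms independent_paraboloid_lift in auto)

lemma spheres_and_planes_imp_functional: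
  assumes "T \<in> spheres_and_planes"
  obtains k where "k \<noteq> 0" "T = {v. k \<bullet> paraboloid_lift v = 0}"
proof -
  consider c r where "T = sphere c r" "0 < r" | a b where "T = {x. a \<bullet> x = b}" "a \<noteq> 0"
    using assms by (auto simp: spheres_and_planes_def)
  then show thesis
  proof cases
    case 1
    have "v \<in> sphere c r \<longleftrightarrow> (c \<bullet> c - r\<^sup>2, - 2 *\<^sub>R c, 1) \<bullet> paraboloid_lift v = 0" for v
    proof -
      have "v \<in> sphere c r \<longleftrightarrow> (norm (v - c))\<^sup>2 = r\<^sup>2"
        using 1(2) by (simp add: dist_norm norm_minus_commute)
      also have "\<dots> \<longleftrightarrow> (c \<bullet> c - r\<^sup>2, - 2 *\<^sub>R c, 1) \<bullet> paraboloid_lift v = 0"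
        by (auto simp: power2_norm_eq_inner paraboloid_lift_def inner_diff inner_commute)
      finally show ?thesis .
    qed
    then have "T = {v. (c \<bullet> c - r\<^sup>2, - 2 *\<^sub>R c, 1) \<bullet> paraboloid_lift v = 0}"
      unfolding 1(1) by blast
    then show thesis
      by (intro that) (simp_all add: zero_prod_def)
  next
    case 2
    have "T = {v. (- b, a, 0) \<bullet> paraboloid_lift v = 0}"
      unfolding 2(1) by (simp add: paraboloid_lift_def)
    then show thesis
      using 2(2) by (intro that) (simp_all add: zero_prod_def)
  qed
qed

text \<open>Completing the square. If the quadratic coefficient is nonzero, two distinct zeros
  exclude the empty set and the single point; otherwise a zero excludes a nonzero constant.\<close>

lemma functional_imp_spheres_and_planes:
  assumes "k \<noteq> 0" "u \<noteq> v" "k \<bullet> paraboloid_lift u = 0" "k \<bullet> paraboloid_lift v = 0"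
  shows "{x. k \<bullet> paraboloid_lift x = 0} \<in> spheres_and_planes"
proof -
  obtain d a m where k: "k = (d, a, m)" by (cases k)
  have eq: "k \<bullet> paraboloid_lift x = d + a \<bullet> x + m * (x \<bullet> x)" for x
    by (simp add: k paraboloid_lift_def)
  show ?thesis
  proof (cases "m = 0")
    case True
    then have "a \<noteq> 0" using assms(1,3) eq[of u] by (auto simp: k zero_prod_def)
    moreover have "{x. k \<bullet> paraboloid_lift x = 0} = {x. a \<bullet> x = - d}"
      by (auto simp: eq True)
    ultimately show ?thesis unfolding spheres_and_planes_def by blast
  next
    case False
    define c where "c = - (1 / (2 * m)) *\<^sub>R a"
    have ac: "a = - (2 * m) *\<^sub>R c" using False by (simp add: c_def)
    define R where "R = c \<bullet> c - d / m"
    have iff: "k \<bullet> paraboloid_lift x = 0 \<longleftrightarrow> (norm (x - c))\<^sup>2 = R" for x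
    proof -
      have "k \<bullet> paraboloid_lift x = m * ((norm (x - c))\<^sup>2 - R)"
        using False unfolding eq R_def power2_norm_eq_inner
        by (subst ac) (simp add: inner_diff inner_commute[of c x] algebra_simps)
      then show ?thesis using False by simp
    qed
    have "R > 0"
    proof -
      have "(norm (u - c))\<^sup>2 = R" "(norm (v - c))\<^sup>2 = R" using assms iff by auto
      moreover have "u - c \<noteq> 0 \<or> v - c \<noteq> 0" using assms(2) by auto
      ultimately show ?thesis by (metis zero_less_norm_iff zero_less_power)
    qed
    have "{x. k \<bullet> paraboloid_lift x = 0} = sphere c (sqrt R)"
    proof -
      have "(norm (x - c))\<^sup>2 = R \<longleftrightarrow> dist c x = sqrt R" for x
        using \<open>R > 0\<close> by (auto simp: dist_norm norm_minus_commute)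
      then show ?thesis unfolding iff sphere_def by simp
    qed
    moreover have "0 < sqrt R" using \<open>R > 0\<close> by simp
    ultimately show ?thesis unfolding spheres_and_planes_def by blast
  qed
qed

lemma independent_insert_orthogonal:
  fixes B :: "'a::euclidean_space set"
  assumes "independent B" "k \<noteq> 0" "\<And>b. b \<in> B \<Longrightarrow> k \<bullet> b = 0"
  shows "independent (insert k B)" "k \<notin> B"
proof -
  have "k \<notin> span B"
  proof
    assume "k \<in> span B"
    then have "orthogonal k k"
      by (rule orthogonal_to_span) (use assms(3) in \<open>auto simp: orthogonal_def\<close>)
    with assms(2) show False by (simp add: orthogonal_self)
  qed
  then show "independent (insert k B)" "k \<notin> B"
    using assms(1) by (auto simp: independent_insert span_base)
qed

text \<open>Otherwise the part \<open>q\<close> of \<open>l\<close> orthogonal to \<open>k\<close>,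
  together with \<open>k\<close> and \<open>B\<close>, would be an independent set with more than
  \<open>DIM('a)\<close> elements.\<close>

lemma codim_1_orthogonal_unique:
  fixes B :: "'a::euclidean_space set"
  assumes "independent B" "Suc (card B) = DIM('a)" "k \<noteq> 0"
    and k: "\<And>b. b \<in> B \<Longrightarrow> k \<bullet> b = 0" and l: "\<And>b. b \<in> B \<Longrightarrow> l \<bullet> b = 0"
  shows "\<exists>m. l = m *\<^sub>R k"
proof (rule ccontr)
  assume no: "\<nexists>m. l = m *\<^sub>R k"
  define q where "q = l - ((l \<bullet> k) / (k \<bullet> k)) *\<^sub>R k"
  have "q \<noteq> 0" using no by (auto simp: q_def)
  moreover have "q \<bullet> b = 0" if "b \<in> insert k B" for b
    using that k l \<open>k \<noteq> 0\<close> by (auto simp: q_def inner_diff_left)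
  ultimately have "independent (insert q (insert k B))" "q \<notin> insert k B" "k \<notin> B"
    using independent_insert_orthogonal assms(1,3) k by metis+
  moreover have "finite B" using assms(1) independent_imp_finite by blast
  ultimately show False
    using independent_card_le[of "insert q (insert k B)"] assms(2) by simp
qed

lemma exists_orthogonal_vector:
  fixes B :: "'a::euclidean_space set"
  assumes "finite B" "card B < DIM('a)"
  obtains k where "k \<noteq> 0" "\<And>b. b \<in> span B \<Longrightarrow> k \<bullet> b = 0"
proof -
  have "dim B < DIM('a)"
    using dim_le_card[OF span_superset assms(1)] assms(2) by simp
  then show thesis
    using orthogonal_to_subspace_exists[of B] that by (auto simp: orthogonal_def)
qed

text \<open>If the lift of \<open>z\<close> were in the span of the other three, so would be the
  lift of \<open>p\<close>, which is off the circle. Hence four lifts are independent in dimension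
  5, and the functionals vanishing on them form a line: exactly one sphere or plane, which also
  contains \<open>p\<close>.\<close>

lemma sphere_or_circle_through:
  assumes dist: "distinct [w, x, y]"
    and p: "paraboloid_lift p \<in> span {paraboloid_lift w, paraboloid_lift x, paraboloid_lift y, paraboloid_lift z}"
    and "p \<notin> circle_through w x y"
  shows "\<exists>T\<in>spheres_and_planes. {w, x, y, z} \<subseteq> T \<and> p \<in> T \<and>
    (\<forall>T'\<in>spheres_and_planes. {w, x, y, z} \<subseteq> T' \<longrightarrow> T' = T)"
proof -
  let ?L = paraboloid_lift
  let ?B = "{?L w, ?L x, ?L y, ?L z}"
  have z: "?L z \<notin> span {?L w, ?L x, ?L y}"
  proof
    assume "?L z \<in> span {?L w, ?L x, ?L y}"
    then have "span (insert (?L z) {?L w, ?L x, ?L y}) = span {?L w, ?L x, ?L y}"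
      by (rule span_redundant)
    with p assms(3) show False
      by (simp add: circle_through_def insert_commute)
  qed
  have B: "?B = insert (?L z) {?L w, ?L x, ?L y}" by auto
  have indep: "independent ?B"
    unfolding B using z independent_paraboloid_lift(1)[OF dist] by (rule independent_insertI)
  have "?L z \<notin> {?L w, ?L x, ?L y}" using z by (rule contrapos_nn) (rule span_base)
  then have card: "card ?B = 4"
    unfolding B using independent_paraboloid_lift(2)[OF dist] by (subst card_insert_disjoint) auto
  obtain k where k: "k \<noteq> 0" "\<And>b. b \<in> span ?B \<Longrightarrow> k \<bullet> b = 0"
    using exists_orthogonal_vector[of ?B] card by auto
  let ?T = "{v. k \<bullet> ?L v = 0}"
  have kB: "k \<bullet> b = 0" if "b \<in> ?B" for b
    using k(2)[OF span_base[OF that]] .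
  have sub: "{w, x, y, z} \<subseteq> ?T" by (simp add: kB)
  have "?T \<in> spheres_and_planes"
    using functional_imp_spheres_and_planes[OF k(1), of w x] sub dist by auto
  moreover have "p \<in> ?T" using k(2)[OF p] by simp
  moreover have "T' = ?T" if T': "T' \<in> spheres_and_planes" "{w, x, y, z} \<subseteq> T'" for T'
  proof -
    obtain l where l: "l \<noteq> 0" "T' = {v. l \<bullet> ?L v = 0}"
      using spheres_and_planes_imp_functional[OF T'(1)] by metis
    have "\<exists>m. l = m *\<^sub>R k"
    proof (rule codim_1_orthogonal_unique[OF indep])
      show "l \<bullet> b = 0" if "b \<in> ?B" for b
        using that T'(2) l(2) by auto
      show "k \<bullet> b = 0" if "b \<in> ?B" for b
        using that by (rule kB)
    qed (simp_all add: card k(1))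
    then obtain m where "l = m *\<^sub>R k" ..
    with l show ?thesis by simp
  qed
  ultimately show ?thesis using sub by blast
qed

text \<open>Serves to show that circles are negligible, so any functional vanishing on the three
  lifts will do.\<close>

lemma circle_through_subset_sphere:
  assumes "a \<noteq> b"
  obtains T where "T \<in> spheres_and_planes" "circle_through a b c \<subseteq> T"
proof -
  let ?B = "{paraboloid_lift a, paraboloid_lift b, paraboloid_lift c}"
  have "card ?B \<le> 3"
    using card_insert_le_m1[of 3 "{paraboloid_lift b, paraboloid_lift c}" "paraboloid_lift a"]
      card_insert_le_m1[of 2 "{paraboloid_lift c}" "paraboloid_lift b"] by simp
  then obtain k where k: "k \<noteq> 0" "\<And>b. b \<in> span ?B \<Longrightarrow> k \<bullet> b = 0"
    using exists_orthogonal_vector[of ?B] by auto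
  have kB: "k \<bullet> b = 0" if "b \<in> ?B" for b
    using k(2)[OF span_base[OF that]] .
  show thesis
  proof
    show "{v. k \<bullet> paraboloid_lift v = 0} \<in> spheres_and_planes"
      by (rule functional_imp_spheres_and_planes[OF k(1) assms]) (simp_all add: kB)
    show "circle_through a b c \<subseteq> {v. k \<bullet> paraboloid_lift v = 0}"
      unfolding circle_through_def using k(2) by blast
  qed
qed

lemma negligible_spheres_and_planes:
  assumes "T \<in> spheres_and_planes"
  shows "negligible T"
  using assms negligible_hyperplane by (auto simp: spheres_and_planes_def negligible_sphere)

section \<open>Inversion and crossings of inverted edges\<close>

lemma norm_inversion_diff:
  "norm (inversion p r x - p) = r\<^sup>2 / norm (x - p)"
  by (simp add: inversion_def power2_eq_square)

lemma inversion_involution: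
  assumes "r \<noteq> 0" "x \<noteq> p"
  shows "inversion p r (inversion p r x) = x"
proof -
  have "inversion p r (inversion p r x) = p + (r\<^sup>2 / (r\<^sup>2 / norm (x - p))\<^sup>2) *\<^sub>R (inversion p r x - p)"
    unfolding norm_inversion_diff[symmetric] by (simp add: inversion_def)
  also have "inversion p r x - p = (r\<^sup>2 / (norm (x - p))\<^sup>2) *\<^sub>R (x - p)"
    by (simp add: inversion_def)
  finally show ?thesis
    using assms by (simp add: power_divide)
qed

lemma inversion_eq_iff:
  assumes "r \<noteq> 0" "x \<noteq> p" "y \<noteq> p"
  shows "inversion p r x = inversion p r y \<longleftrightarrow> x = y"
  using inversion_involution[OF assms(1,2)] inversion_involution[OF assms(1,3)] by metis

text \<open>A common point of two segments between inverted points yields a linear relation between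
  the lifts of the four original points and of the centre. The relation puts the centre on a
  sphere through these points unless its coefficient there vanishes, and then the original
  segments have a common point.\<close>

lemma inverted_segments_meet:
  assumes r: "0 < r" and p: "p \<notin> {w, x, y, z}"
    and q1: "q \<in> closed_segment (inversion p r w) (inversion p r x)"
    and q2: "q \<in> closed_segment (inversion p r y) (inversion p r z)"
  shows "paraboloid_lift p \<in> span {paraboloid_lift w, paraboloid_lift x, paraboloid_lift y, paraboloid_lift z}
    \<or> (\<exists>m \<in> closed_segment w x \<inter> closed_segment y z. m = x \<and> w \<noteq> x \<longrightarrow> q = inversion p r x)"
proof -
  let ?L = paraboloid_lift
  \<comment> \<open>The coefficients are the barycentric weights \<open>1 - s\<close> and
    \<open>s\<close> divided by the squared distances to \<open>p\<close>; the last equation says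
    that the weights add up to 1.\<close>
  have rep: "\<exists>\<alpha> \<beta>. 0 \<le> \<alpha> \<and> 0 \<le> \<beta> \<and> 0 < \<alpha> + \<beta> \<and> q - p = r\<^sup>2 *\<^sub>R (\<alpha> *\<^sub>R (a - p) + \<beta> *\<^sub>R (b - p)) \<and>
      \<alpha> * ((a - p) \<bullet> (a - p)) + \<beta> * ((b - p) \<bullet> (b - p)) = 1"
    if ab: "a \<noteq> p" "b \<noteq> p" and q: "q \<in> closed_segment (inversion p r a) (inversion p r b)" for a b
  proof -
    obtain s where s: "0 \<le> s" "s \<le> 1" and qs: "q = (1 - s) *\<^sub>R inversion p r a + s *\<^sub>R inversion p r b"
      using q by (auto simp: closed_segment_def)
    let ?A = "(a - p) \<bullet> (a - p)" and ?B = "(b - p) \<bullet> (b - p)"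
    have pos: "0 < ?A" "0 < ?B" using ab by auto
    show ?thesis
    proof (rule exI[of _ "(1 - s) / ?A"], rule exI[of _ "s / ?B"], intro conjI)
      show "0 < (1 - s) / ?A + s / ?B"
      proof (cases "s = 0")
        case False
        then show ?thesis using s pos by (intro add_nonneg_pos) auto
      qed (use pos in simp)
      show "q - p = r\<^sup>2 *\<^sub>R (((1 - s) / ?A) *\<^sub>R (a - p) + (s / ?B) *\<^sub>R (b - p))"
        by (simp add: qs inversion_def power2_norm_eq_inner algebra_simps)
    qed (use s pos in auto)
  qed
  obtain \<alpha> \<beta> where ab: "0 \<le> \<alpha>" "0 \<le> \<beta>" "0 < \<alpha> + \<beta>"
    and qab: "q - p = r\<^sup>2 *\<^sub>R (\<alpha> *\<^sub>R (w - p) + \<beta> *\<^sub>R (x - p))"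
    and sab: "\<alpha> * ((w - p) \<bullet> (w - p)) + \<beta> * ((x - p) \<bullet> (x - p)) = 1"
    using rep[OF _ _ q1] p by auto
  obtain \<gamma> \<delta> where cd: "0 \<le> \<gamma>" "0 \<le> \<delta>" "0 < \<gamma> + \<delta>"
    and qcd: "q - p = r\<^sup>2 *\<^sub>R (\<gamma> *\<^sub>R (y - p) + \<delta> *\<^sub>R (z - p))"
    and scd: "\<gamma> * ((y - p) \<bullet> (y - p)) + \<delta> * ((z - p) \<bullet> (z - p)) = 1"
    using rep[OF _ _ q2] p by auto
  define m where "m = \<alpha> + \<beta> - \<gamma> - \<delta>"
  have vec: "\<alpha> *\<^sub>R (w - p) + \<beta> *\<^sub>R (x - p) = \<gamma> *\<^sub>R (y - p) + \<delta> *\<^sub>R (z - p)"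
    using qab qcd r by simp
  then have v: "\<alpha> *\<^sub>R w + \<beta> *\<^sub>R x - \<gamma> *\<^sub>R y - \<delta> *\<^sub>R z = m *\<^sub>R p"
    by (simp add: m_def algebra_simps)
  show ?thesis
  proof (cases "m = 0")
    case False
    \<comment> \<open>Pairing the vector relation with \<open>p\<close> and inserting the two weight
      equations yields the relation between the squares, the last coordinates of the lifts.\<close>
    have "p \<bullet> (\<alpha> *\<^sub>R w + \<beta> *\<^sub>R x - \<gamma> *\<^sub>R y - \<delta> *\<^sub>R z) = p \<bullet> (m *\<^sub>R p)"
      using v by simp
    then have "\<alpha> * (w \<bullet> w) + \<beta> * (x \<bullet> x) - \<gamma> * (y \<bullet> y) - \<delta> * (z \<bullet> z) = m * (p \<bullet> p)"
      using sab scd by (simp add: m_def inner_diff inner_add inner_commute algebra_simps)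
    then have "\<alpha> *\<^sub>R ?L w + \<beta> *\<^sub>R ?L x - \<gamma> *\<^sub>R ?L y - \<delta> *\<^sub>R ?L z = m *\<^sub>R ?L p"
      using v by (simp add: paraboloid_lift_def m_def)
    then have "?L p = (1 / m) *\<^sub>R (\<alpha> *\<^sub>R ?L w + \<beta> *\<^sub>R ?L x - \<gamma> *\<^sub>R ?L y - \<delta> *\<^sub>R ?L z)"
      using False by simp
    also have "\<dots> \<in> span {?L w, ?L x, ?L y, ?L z}"
      by (intro span_scale span_diff span_add span_base) auto
    finally show ?thesis by blast
  next
    case True
    \<comment> \<open>With \<open>m = 0\<close> both combinations have the same total weight;
      dividing by it gives one point on both original segments.\<close>
    let ?\<sigma> = "\<alpha> + \<beta>"
    have \<sigma>: "\<gamma> + \<delta> = ?\<sigma>" using True by (simp add: m_def)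
    define u where "u = (1 / ?\<sigma>) *\<^sub>R (\<alpha> *\<^sub>R w + \<beta> *\<^sub>R x)"
    have u2: "u = (1 / ?\<sigma>) *\<^sub>R (\<gamma> *\<^sub>R y + \<delta> *\<^sub>R z)"
      using v True by (simp add: u_def algebra_simps)
    have seg: "(1 / (a + b)) *\<^sub>R (a *\<^sub>R c + b *\<^sub>R d) \<in> closed_segment c d"
      if "0 \<le> a" "0 \<le> b" "0 < a + b" for a b and c d :: "real^3"
    proof -
      have "(1 / (a + b)) *\<^sub>R (a *\<^sub>R c + b *\<^sub>R d) = (1 - b / (a + b)) *\<^sub>R c + (b / (a + b)) *\<^sub>R d"
        using that by (simp add: diff_divide_eq_iff scaleR_add_right)
      moreover have "0 \<le> b / (a + b)" "b / (a + b) \<le> 1" using that by auto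
      ultimately show ?thesis unfolding closed_segment_def by blast
    qed
    have "u \<in> closed_segment w x" unfolding u_def using seg ab by blast
    moreover have "u \<in> closed_segment y z" unfolding u2 \<sigma>[symmetric] using seg cd by blast
    \<comment> \<open>Meant for adjacent edges, where \<open>y = x\<close> and the common point is
      the shared vertex: all weight of \<open>q\<close> then sits on \<open>x\<close>.\<close>
    moreover have "q = inversion p r x" if "u = x" "w \<noteq> x"
    proof -
      have "?\<sigma> *\<^sub>R u = \<alpha> *\<^sub>R w + \<beta> *\<^sub>R x" using ab(3) by (simp add: u_def)
      then have "\<alpha> *\<^sub>R (x - w) = 0" using that(1) by (simp add: algebra_simps)
      then have "\<alpha> = 0" using that(2) by simp
      with sab have "\<beta> = 1 / (norm (x - p))\<^sup>2"
        by (auto simp: power2_norm_eq_inner eq_divide_eq)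
      with qab \<open>\<alpha> = 0\<close> have "q - p = (r\<^sup>2 / (norm (x - p))\<^sup>2) *\<^sub>R (x - p)" by simp
      then show ?thesis by (simp add: inversion_def algebra_simps)
    qed
    ultimately show ?thesis by blast
  qed
qed

text \<open>Triples of vertices fill both gaps left by the spheres: concyclic or collinear
  four-tuples, and adjacent edges, which have only three ends.\<close>

definition vertex_circles :: "(real^3) list \<Rightarrow> (real^3) set" where
  "vertex_circles vs = \<Union>{circle_through a b c | a b c. {a, b, c} \<subseteq> set vs \<and> distinct [a, b, c]}"

text \<open>In \<open>inverted_segments_meet\<close>, a common point of the original edges is
  impossible or is their shared vertex, because \<open>K\<close> is embedded. The other alternative
  puts \<open>p\<close> on a vertex circle or, for nonadjacent edges, possibly on a member of
  \<open>edge_pair_spheres K\<close>.\<close>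

lemma embedded_polygon_inversion:
  assumes emb: "embedded_polygon K" and r: "0 < r" and pK: "p \<notin> set K"
    and p1: "p \<notin> \<Union>(edge_pair_spheres K)" and p2: "p \<notin> vertex_circles K"
  shows "embedded_polygon (polygonal_inversion p r K)"
proof -
  let ?n = "length K" and ?s = "\<lambda>i. Suc i mod length K" and ?I = "inversion p r"
  have n: "3 \<le> ?n" and dist: "distinct K"
    and meet: "\<And>i j. i < ?n \<Longrightarrow> j < ?n \<Longrightarrow> i \<noteq> j \<Longrightarrow> edge K i \<inter> edge K j = edge_ends K i \<inter> edge_ends K j"
    using emb by (auto simp: embedded_polygon_def)
  have s_lt: "?s i < ?n" for i using n by (intro mod_less_divisor) auto
  have s_neq: "?s i \<noteq> i" "?s (?s i) \<noteq> i" if "i < ?n" for i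
    using n that by (auto simp: mod_Suc)
  have ext: "K ! i = K ! j \<longleftrightarrow> i = j" if "i < ?n" "j < ?n" for i j
    using that dist nth_eq_iff_index_eq by blast
  have np: "K ! i \<noteq> p" if "i < ?n" for i
    using that pK nth_mem by metis
  have circ: "p \<notin> circle_through (K ! i) (K ! j) (K ! k)"
    if "distinct [i, j, k]" "i < ?n" "j < ?n" "k < ?n" for i j k
  proof -
    have "{K ! i, K ! j, K ! k} \<subseteq> set K" "distinct [K ! i, K ! j, K ! k]"
      using that by (auto simp: ext)
    then show ?thesis using p2 unfolding vertex_circles_def by blast
  qed
  let ?V = "polygonal_inversion p r K"
  have len: "length ?V = ?n" by (simp add: polygonal_inversion_def)
  have nth: "?V ! i = ?I (K ! i)" if "i < ?n" for i
    using that by (simp add: polygonal_inversion_def)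
  have edge: "edge ?V i = closed_segment (?I (K ! i)) (?I (K ! ?s i))" if "i < ?n" for i
    using that s_lt by (simp add: edge_def len nth)
  have ends: "edge_ends ?V i = {?I (K ! i), ?I (K ! ?s i)}" if "i < ?n" for i
    using that s_lt by (simp add: edge_ends_def len nth)
  have adj: "edge ?V i \<inter> edge ?V (?s i) \<subseteq> edge_ends ?V i \<inter> edge_ends ?V (?s i)" if i: "i < ?n" for i
  proof
    fix q assume q: "q \<in> edge ?V i \<inter> edge ?V (?s i)"
    let ?w = "K ! i" and ?x = "K ! ?s i" and ?z = "K ! ?s (?s i)"
    have neq: "?w \<noteq> ?x" "?z \<noteq> ?x" "?w \<noteq> ?z"
      using ext s_lt s_neq i by metis+
    \<comment> \<open>The repeated \<open>?x\<close> reduces the four lifts to the three that define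
      a vertex circle.\<close>
    have no: "paraboloid_lift p \<notin> span {paraboloid_lift ?w, paraboloid_lift ?x, paraboloid_lift ?x, paraboloid_lift ?z}"
    proof -
      have "i \<noteq> ?s i" "i \<noteq> ?s (?s i)" "?s i \<noteq> ?s (?s i)" using neq by metis+
      then show ?thesis
        using circ[of i "?s i" "?s (?s i)"] i s_lt by (simp add: circle_through_def)
    qed
    have "closed_segment ?w ?x \<inter> closed_segment ?x ?z = {?x}"
      using meet[OF i s_lt s_neq(1)[OF i, symmetric]] neq by (auto simp: edge_def edge_ends_def)
    then have "q = ?I ?x"
      using inverted_segments_meet[OF r, of p ?w ?x ?x ?z q] no q np i s_lt neq
      by (auto simp: edge)
    then show "q \<in> edge_ends ?V i \<inter> edge_ends ?V (?s i)"
      using i s_lt by (simp add: ends)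
  qed
  have nonadj: "edge ?V i \<inter> edge ?V j = {}"
    if ij: "i < ?n" "j < ?n" "i \<noteq> j" "j \<noteq> ?s i" "i \<noteq> ?s j" for i j
  proof (rule ccontr)
    assume "edge ?V i \<inter> edge ?V j \<noteq> {}"
    then obtain q where q: "q \<in> edge ?V i" "q \<in> edge ?V j" by blast
    let ?w = "K ! i" and ?x = "K ! ?s i" and ?y = "K ! j" and ?z = "K ! ?s j"
    have disj: "edge_ends K i \<inter> edge_ends K j = {}"
      using edge_ends_disjoint dist ij by blast
    then have "closed_segment ?w ?x \<inter> closed_segment ?y ?z = {}"
      using meet ij by (simp add: edge_def)
    then have "paraboloid_lift p \<in> span {paraboloid_lift ?w, paraboloid_lift ?x, paraboloid_lift ?y, paraboloid_lift ?z}"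
      using inverted_segments_meet[OF r, of p ?w ?x ?y ?z q] q np ij s_lt
      by (auto simp: edge)
    moreover have "distinct [?w, ?x, ?y]"
      using ext s_lt s_neq(1)[OF ij(1)] ij by auto
    moreover have "p \<notin> circle_through ?w ?x ?y"
      using circ[of i "?s i" j] s_lt s_neq(1)[OF ij(1)] ij by auto
    ultimately obtain T where T: "T \<in> spheres_and_planes" "{?w, ?x, ?y, ?z} \<subseteq> T" "p \<in> T"
      "\<forall>T'\<in>spheres_and_planes. {?w, ?x, ?y, ?z} \<subseteq> T' \<longrightarrow> T' = T"
      using sphere_or_circle_through by metis
    have un: "edge_ends K i \<union> edge_ends K j = {?w, ?x, ?y, ?z}"
      by (auto simp: edge_ends_def)
    have "T \<in> edge_pair_spheres K"
      unfolding edge_pair_spheres_def nonadjacent_def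
    proof (intro CollectI conjI)
      show "\<exists>i<?n. \<exists>j<?n. edge_ends K i \<inter> edge_ends K j = {} \<and> edge_ends K i \<union> edge_ends K j \<subseteq> T \<and>
          (\<forall>T'\<in>spheres_and_planes. edge_ends K i \<union> edge_ends K j \<subseteq> T' \<longrightarrow> T' = T)"
        by (rule exI[of _ i], rule conjI[OF ij(1)], rule exI[of _ j], rule conjI[OF ij(2)])
          (use T(2,4) disj in \<open>simp only: un simp_thms\<close>)
    qed (fact T(1))
    with T(3) p1 show False by blast
  qed
  have sub: "edge ?V i \<inter> edge ?V j \<subseteq> edge_ends ?V i \<inter> edge_ends ?V j" if "i < ?n" "j < ?n" "i \<noteq> j" for i j
    using adj[of i] adj[of j] nonadj[of i j] that by blast
  have sup: "edge_ends ?V i \<subseteq> edge ?V i" for i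
    by (simp add: edge_ends_def edge_def)
  have "inj_on ?I (set K)"
  proof (rule inj_onI)
    fix x y assume "x \<in> set K" "y \<in> set K" "?I x = ?I y"
    then show "x = y"
      using inversion_eq_iff[of r x p y] r pK by (metis less_irrefl)
  qed
  then have "distinct ?V"
    using dist by (simp add: polygonal_inversion_def distinct_map)
  then show ?thesis
    unfolding embedded_polygon_def len using n sub sup by blast
qed

section \<open>Vertex circles are small and can be avoided\<close>

text \<open>Each vertex lies on its circle with two further ones. Hence a centre off all vertex
  circles automatically differs from the vertices.\<close>

lemma set_subset_vertex_circles:
  assumes "distinct K" "3 \<le> length K"
  shows "set K \<subseteq> vertex_circles K"
proof
  fix v assume v: "v \<in> set K"
  have "2 \<le> card (set K - {v})"
    using assms v by (simp add: distinct_card)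
  then obtain B where B: "B \<subseteq> set K - {v}" "card B = 2"
    using obtain_subset_with_card_n by metis
  then obtain b c where bc: "B = {b, c}" "b \<noteq> c" by (auto simp: card_2_iff)
  have "{v, b, c} \<subseteq> set K" "distinct [v, b, c]" using B(1) bc v by auto
  moreover have "v \<in> circle_through v b c"
    by (simp add: circle_through_def span_base)
  ultimately show "v \<in> vertex_circles K" unfolding vertex_circles_def by blast
qed

lemma finite_circles:
  "finite {circle_through a b c | a b c. {a, b, c} \<subseteq> set K \<and> distinct [a, b, c]}"
proof (rule finite_subset)
  show "{circle_through a b c | a b c. {a, b, c} \<subseteq> set K \<and> distinct [a, b, c]}
    \<subseteq> (\<lambda>(a, b, c). circle_through a b c) ` (set K \<times> set K \<times> set K)" by auto
qed auto

lemma negligible_vertex_circles: "negligible (vertex_circles K)"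
  unfolding vertex_circles_def
proof (rule negligible_Union[OF finite_circles])
  fix t assume "t \<in> {circle_through a b c | a b c. {a, b, c} \<subseteq> set K \<and> distinct [a, b, c]}"
  then obtain a b c where t: "t = circle_through a b c" "a \<noteq> b" by auto
  then show "negligible t"
    using circle_through_subset_sphere[of a b c] negligible_spheres_and_planes negligible_subset by metis
qed

text \<open>The lifts of three distinct points \<open>d\<close>, \<open>e\<close>, \<open>f\<close>
  of the circle span the lifts of \<open>a\<close>, \<open>b\<close>, \<open>c\<close>; the first
  coordinate turns these linear combinations into affine combinations of \<open>d\<close>,
  \<open>e\<close>, \<open>f\<close>.\<close>

lemma circle_through_subset_affine:
  assumes "affine A" "infinite (A \<inter> circle_through a b c)"
  shows "{a, b, c} \<subseteq> A"
proof -
  let ?L = paraboloid_lift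
  obtain D where D: "D \<subseteq> A \<inter> circle_through a b c" "card D = 3"
    using infinite_arbitrarily_large[OF assms(2)] by metis
  then obtain d e f where def: "D = {d, e, f}" "distinct [d, e, f]"
    by (auto simp: card_3_iff)
  have "span {?L a, ?L b, ?L c} \<subseteq> span {?L d, ?L e, ?L f}"
    by (rule span_subset_span_paraboloid_lift[OF def(2)]) (use D(1) def(1) in \<open>auto simp: circle_through_def\<close>)
  moreover have "v \<in> A" if v: "?L v \<in> span {?L d, ?L e, ?L f}" for v
  proof -
    obtain i j k where "?L v = i *\<^sub>R ?L d + j *\<^sub>R ?L e + k *\<^sub>R ?L f"
      using v unfolding in_span_insert3 by blast
    then have "i + j + k = 1" "v = i *\<^sub>R d + j *\<^sub>R e + k *\<^sub>R f"
      by (simp_all add: paraboloid_lift_def)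
    then have "v \<in> affine hull {d, e, f}"
      unfolding affine_hull_3 by blast
    also have "\<dots> \<subseteq> A"
      using D(1) def(1) assms(1) by (intro hull_minimal) auto
    finally show ?thesis .
  qed
  ultimately show ?thesis by (auto intro: span_base)
qed

text \<open>The circle through three collinear points is their whole line: the lifted line is a
  parabola in a three-dimensional space, which the three lifts already span.\<close>

lemma affine_hull_2_subset_circle_through:
  assumes "distinct [a, b, c]" "{a, b, c} \<subseteq> affine hull {x, y}"
  shows "x \<in> circle_through a b c"
proof -
  let ?L = paraboloid_lift
  \<comment> \<open>\<open>?M\<close> is the derivative of the lift at \<open>x\<close> in the
    direction \<open>y - x\<close>, and \<open>?N\<close> is the direction of the second
    derivative.\<close>
  let ?M = "(0, y - x, 2 * (x \<bullet> (y - x))) :: real \<times> (real^3) \<times> real" and ?N = "(0, 0, 1) :: real \<times> (real^3) \<times> real"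
  have "?L v \<in> span {?L x, ?M, ?N}" if v: "v \<in> affine hull {x, y}" for v
  proof -
    obtain i j where "i + j = 1" "v = i *\<^sub>R x + j *\<^sub>R y"
      using v unfolding affine_hull_2 by blast
    then have "v = x + j *\<^sub>R (y - x)"
      by (simp add: algebra_simps flip: scaleR_add_left)
    then have "?L v = 1 *\<^sub>R ?L x + j *\<^sub>R ?M + (j\<^sup>2 * ((y - x) \<bullet> (y - x))) *\<^sub>R ?N"
      by (simp add: paraboloid_lift_def inner_add_left inner_add_right inner_commute power2_eq_square)
    then show ?thesis unfolding in_span_insert3 by blast
  qed
  then have "{?L a, ?L b, ?L c} \<subseteq> span {?L x, ?M, ?N}" using assms(2) by blast
  from span_subset_span_paraboloid_lift[OF assms(1) this]
  show ?thesis by (auto simp: circle_through_def intro: span_base)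
qed

lemma affine_hull_3_exchange:
  assumes "v \<in> affine hull {x, y, c}" "v \<notin> affine hull {x, y}"
  shows "c \<in> affine hull {x, y, v :: 'a::real_vector}"
proof -
  obtain i j k where s: "i + j + k = 1" and v: "v = i *\<^sub>R x + j *\<^sub>R y + k *\<^sub>R c"
    using assms(1) unfolding affine_hull_3 by blast
  have "k \<noteq> 0"
  proof
    assume "k = 0"
    then have "v \<in> affine hull {x, y}" unfolding affine_hull_2 using s v by auto
    with assms(2) show False ..
  qed
  then have "c = (- i / k) *\<^sub>R x + (- j / k) *\<^sub>R y + (1 / k) *\<^sub>R v"
    by (simp add: v scaleR_add_right)
  moreover have "- i / k + - j / k + 1 / k = 1"
    using s \<open>k \<noteq> 0\<close> by (simp add: field_simps)
  ultimately show ?thesis unfolding affine_hull_3 by blast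
qed

lemma negligible_affine_hull_3: "negligible (affine hull {x, y, z :: real^3})"
proof -
  have "card {x, y, z} \<le> 3"
    using card_insert_le_m1[of 3 "{y, z}" x] card_insert_le_m1[of 2 "{z}" y] by simp
  then have "aff_dim (affine hull {x, y, z}) < int DIM(real^3)"
    using aff_dim_le_card[of "{x, y, z}"] by simp
  then obtain a b where "a \<noteq> 0" "affine hull {x, y, z} \<subseteq> {x. a \<bullet> x = b}"
    by (rule aff_lowdim_subset_hyperplane)
  then show ?thesis
    using negligible_hyperplane negligible_subset by blast
qed

text \<open>A circle meeting the plane infinitely often has its three vertices there. As
  \<open>c\<close> is chosen off the planes through \<open>x\<close>, \<open>y\<close> and a vertex,
  these vertices lie on the line through \<open>x\<close> and \<open>y\<close>; then the circle is
  that line and contains \<open>x\<close>, which is generic.\<close>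

lemma exists_plane_meeting_vertex_circles_finitely:
  assumes U: "open U" "x \<in> U" and x: "x \<notin> vertex_circles K" and "x \<noteq> y"
  obtains c where "c \<in> U" "\<not> collinear {x, y, c}" "finite (affine hull {x, y, c} \<inter> vertex_circles K)"
proof -
  \<comment> \<open>Inserting \<open>x\<close> adds the degenerate hull of \<open>{x, y, x}\<close>,
    the line itself, so that \<open>c\<close> is not collinear with \<open>x\<close> and
    \<open>y\<close>.\<close>
  have "negligible (\<Union>v\<in>insert x (set K). affine hull {x, y, v})"
    using negligible_affine_hull_3 by (intro negligible_Union) auto
  then have "\<not> U \<subseteq> (\<Union>v\<in>insert x (set K). affine hull {x, y, v})"
    using U open_not_negligible negligible_subset by (metis empty_iff)
  then obtain c where "c \<in> U" and c: "c \<notin> affine hull {x, y, x}" "\<And>v. v \<in> set K \<Longrightarrow> c \<notin> affine hull {x, y, v}"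
    by auto
  show thesis
  proof
    have "{x, y, x} = {x, y}" by auto
    then show "\<not> collinear {x, y, c}"
      using c(1) collinear_3_affine_hull[OF \<open>x \<noteq> y\<close>] by simp
    have "finite (affine hull {x, y, c} \<inter> t)"
      if circ: "t \<in> {circle_through a b c | a b c. {a, b, c} \<subseteq> set K \<and> distinct [a, b, c]}" for t
    proof (rule ccontr)
      assume inf: "infinite (affine hull {x, y, c} \<inter> t)"
      obtain d e f where t: "t = circle_through d e f" and K: "{d, e, f} \<subseteq> set K" and dist: "distinct [d, e, f]"
        using circ by auto
      have "{d, e, f} \<subseteq> affine hull {x, y, c}"
        using circle_through_subset_affine[OF affine_affine_hull inf[unfolded t]] .
      then have "{d, e, f} \<subseteq> affine hull {x, y}"
        using affine_hull_3_exchange c(2) K by blast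
      then have "x \<in> t" unfolding t using dist by (intro affine_hull_2_subset_circle_through)
      with circ x show False unfolding vertex_circles_def by blast
    qed
    then have "finite (\<Union>t\<in>{circle_through a b c | a b c. {a, b, c} \<subseteq> set K \<and> distinct [a, b, c]}. affine hull {x, y, c} \<inter> t)"
      by (intro finite_UN_I finite_circles)
    then show "finite (affine hull {x, y, c} \<inter> vertex_circles K)"
      unfolding vertex_circles_def Int_Union .
  qed fact
qed

section \<open>Counting pairs of nonadjacent edges\<close>

text \<open>Each \<open>i\<close> rules out itself, its successor and its predecessor
  \<open>pr i\<close>, three different indices. Ordered pairs are counted, so this is twice the
  final bound.\<close>

lemma card_nonadjacent_pairs_le:
  assumes n: "3 \<le> length K"
  shows "card {(i, j). i < length K \<and> j < length K \<and> nonadjacent K i j} \<le> length K * (length K - 3)"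
proof -
  let ?n = "length K"
  define pr where "pr i = (if i = 0 then ?n - 1 else i - 1)" for i
  have pr: "Suc (pr i) mod ?n = i" if "i < ?n" for i
    using that n by (auto simp: pr_def)
  let ?J = "\<lambda>i. {..<?n} - {i, Suc i mod ?n, pr i}"
  have card: "card (?J i) = ?n - 3" if "i < ?n" for i
  proof -
    have "{i, Suc i mod ?n, pr i} \<subseteq> {..<?n}" "card {i, Suc i mod ?n, pr i} = 3"
      using that n by (auto simp: pr_def mod_Suc)
    then show ?thesis by (simp add: card_Diff_subset)
  qed
  have "{(i, j). i < ?n \<and> j < ?n \<and> nonadjacent K i j} \<subseteq> Sigma {..<?n} ?J"
    using pr by (auto simp: nonadjacent_def edge_ends_def)
  then have "card {(i, j). i < ?n \<and> j < ?n \<and> nonadjacent K i j} \<le> card (Sigma {..<?n} ?J)"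
    by (intro card_mono) auto
  also have "\<dots> = ?n * (?n - 3)" using card by simp
  finally show ?thesis .
qed

text \<open>Uniqueness makes each sphere a function, given by \<open>THE\<close>, of its unordered
  pair of edges; restricting to \<open>i < j\<close> halves the count.\<close>

lemma edge_pair_spheres_bound:
  assumes n: "3 \<le> length K"
  shows "finite (edge_pair_spheres K)"
    and "real (card (edge_pair_spheres K)) \<le> real (length K) * (real (length K) - 3) / 2"
proof -
  let ?n = "length K"
  let ?N = "{(i, j). i < ?n \<and> j < ?n \<and> nonadjacent K i j}"
  let ?M = "{(i, j). i < j \<and> j < ?n \<and> nonadjacent K i j}"
  let ?P = "\<lambda>i j T. T \<in> spheres_and_planes \<and> edge_ends K i \<union> edge_ends K j \<subseteq> T"
  have fin: "finite ?N" "finite ?M"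
    by (rule finite_subset[of _ "{..<?n} \<times> {..<?n}"]; auto)+
  have sym: "nonadjacent K i j \<longleftrightarrow> nonadjacent K j i" for i j
    by (auto simp: nonadjacent_def)
  have irrefl: "\<not> nonadjacent K i i" for i
    by (simp add: nonadjacent_def edge_ends_def)
  have "?N = ?M \<union> prod.swap ` ?M"
    using sym irrefl by (auto simp: image_iff) (metis linorder_neqE_nat)
  moreover have "?M \<inter> prod.swap ` ?M = {}" by auto
  ultimately have "card ?N = card ?M + card (prod.swap ` ?M)"
    using fin by (simp add: card_Un_disjoint)
  also have "card (prod.swap ` ?M) = card ?M"
    by (intro card_image) (simp add: inj_on_def)
  finally have N: "card ?N = 2 * card ?M" by simp
  have sub: "edge_pair_spheres K \<subseteq> (\<lambda>(i, j). THE T. ?P i j T) ` ?M"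
  proof
    fix S assume "S \<in> edge_pair_spheres K"
    then obtain i j where ij: "i < ?n" "j < ?n" "nonadjacent K i j"
      and S: "?P i j S" "\<And>T. ?P i j T \<Longrightarrow> T = S"
      unfolding edge_pair_spheres_def by blast
    have eq: "(THE T. ?P i j T) = S"
      using S by (rule the_equality)
    then have eq': "(THE T. ?P j i T) = S"
      by (simp only: Un_commute)
    have "i < j \<or> j < i"
      using ij(3) irrefl by (metis linorder_neqE_nat)
    then show "S \<in> (\<lambda>(i, j). THE T. ?P i j T) ` ?M"
    proof
      assume "i < j"
      then show ?thesis using ij eq by (intro image_eqI[of _ _ "(i, j)"]) auto
    next
      assume "j < i"
      then show ?thesis using ij eq' sym[of i j] by (intro image_eqI[of _ _ "(j, i)"]) auto
    qed
  qed
  then show "finite (edge_pair_spheres K)"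
    using fin(2) finite_surj by blast
  have "card (edge_pair_spheres K) \<le> card ?M"
    using sub fin(2) by (rule surj_card_le[rotated])
  then have "2 * card (edge_pair_spheres K) \<le> ?n * (?n - 3)"
    using card_nonadjacent_pairs_le[OF n] N by linarith
  then have "2 * real (card (edge_pair_spheres K)) \<le> real ?n * real (?n - 3)"
    by (metis of_nat_le_iff of_nat_mult of_nat_numeral)
  \<comment> \<open>By \<open>3 \<le> length K\<close> the truncated difference agrees with the real
    one.\<close>
  then show "real (card (edge_pair_spheres K)) \<le> real ?n * (real ?n - 3) / 2"
    using n by simp
qed

section \<open>Dependence on the centre and on the radius\<close>

lemma isCont_inversion_center:
  assumes "v \<noteq> p"
  shows "isCont (\<lambda>q. inversion q r v) p"
  unfolding inversion_def using assms by (intro continuous_intros) auto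

text \<open>The finitely many inverted vertices depend continuously on the centre. The centre
  \<open>p\<close> may be nongeneric, which later allows it to be replaced by a generic one.\<close>

lemma polygonal_inversion_stable:
  assumes pK: "p \<notin> set K" and emb: "embedded_polygon (polygonal_inversion p r K)"
  shows "\<exists>\<epsilon>>0. \<forall>q\<in>ball p \<epsilon>. embedded_polygon (polygonal_inversion q r K) \<and>
    ambient_isotopic (polygon (polygonal_inversion p r K)) (polygon (polygonal_inversion q r K))"
proof -
  obtain \<eta> where "\<eta> > 0" and \<eta>: "\<And>ws. length ws = length (polygonal_inversion p r K) \<Longrightarrow>
      (\<forall>i<length (polygonal_inversion p r K). dist (ws ! i) (polygonal_inversion p r K ! i) < \<eta>) \<Longrightarrow>
      embedded_polygon ws \<and> ambient_isotopic (polygon (polygonal_inversion p r K)) (polygon ws)"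
    using embedded_polygon_stable[OF emb] by blast
  have "\<forall>v\<in>set K. \<forall>\<^sub>F q in nhds p. dist (inversion q r v) (inversion p r v) < \<eta>"
  proof
    fix v assume "v \<in> set K"
    then have "v \<noteq> p" using pK by blast
    then have "((\<lambda>q. inversion q r v) \<longlongrightarrow> inversion p r v) (nhds p)"
      using isCont_inversion_center[of v p r] by (simp add: isCont_def tendsto_nhds_iff)
    then show "\<forall>\<^sub>F q in nhds p. dist (inversion q r v) (inversion p r v) < \<eta>"
      using tendstoD \<open>\<eta> > 0\<close> by blast
  qed
  then have "\<forall>\<^sub>F q in nhds p. \<forall>v\<in>set K. dist (inversion q r v) (inversion p r v) < \<eta>"
    by (intro eventually_ball_finite) auto
  then obtain \<epsilon> where "\<epsilon> > 0" and \<epsilon>: "\<And>q. dist q p < \<epsilon> \<Longrightarrow> \<forall>v\<in>set K. dist (inversion q r v) (inversion p r v) < \<eta>"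
    unfolding eventually_nhds_metric by blast
  have "embedded_polygon (polygonal_inversion q r K) \<and>
    ambient_isotopic (polygon (polygonal_inversion p r K)) (polygon (polygonal_inversion q r K))"
    if "q \<in> ball p \<epsilon>" for q
    using \<epsilon>[of q] that by (intro \<eta>) (auto simp: polygonal_inversion_def dist_commute)
  with \<open>\<epsilon> > 0\<close> show ?thesis by blast
qed

lemma closed_segment_homothety:
  fixes p :: "'a::real_vector"
  shows "(\<lambda>x. p + m *\<^sub>R (x - p)) ` closed_segment a b = closed_segment (p + m *\<^sub>R (a - p)) (p + m *\<^sub>R (b - p))"
proof -
  have "(\<lambda>x. p + m *\<^sub>R (x - p)) ((1 - u) *\<^sub>R a + u *\<^sub>R b)
    = (1 - u) *\<^sub>R (p + m *\<^sub>R (a - p)) + u *\<^sub>R (p + m *\<^sub>R (b - p))" for u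
    by (simp add: algebra_simps)
  then show ?thesis
    unfolding closed_segment_image_interval image_image by simp
qed

lemma homeomorphic_map_homothety:
  fixes p :: "'a::real_normed_vector"
  assumes "m \<noteq> 0"
  shows "homeomorphic_map euclidean euclidean (\<lambda>x. p + m *\<^sub>R (x - p))"
proof -
  have "homeomorphic_maps euclidean euclidean (\<lambda>x. p + m *\<^sub>R (x - p)) (\<lambda>x. p + (1 / m) *\<^sub>R (x - p))"
    unfolding homeomorphic_maps_def using assms by (auto intro!: continuous_intros)
  then show ?thesis using homeomorphic_map_maps by blast
qed

text \<open>At time \<open>t\<close> the straight-line isotopy is the homothety with factor
  \<open>(1 - t) + t * m\<close>, which stays positive.\<close>

lemma ambient_isotopic_homothety:
  assumes "0 < m"
  shows "ambient_isotopic A ((\<lambda>x. p + m *\<^sub>R (x - p)) ` A)"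
proof -
  have eq: "x + t *\<^sub>R ((m - 1) *\<^sub>R (x - p)) = p + (1 + t * (m - 1)) *\<^sub>R (x - p)" for t and x :: "real^3"
    by (simp add: algebra_simps)
  have "ambient_isotopic A ((\<lambda>x. x + (m - 1) *\<^sub>R (x - p)) ` A)"
  proof (rule ambient_isotopic_straight_line)
    show "continuous_on UNIV (\<lambda>x. (m - 1) *\<^sub>R (x - p))"
      by (intro continuous_intros)
    fix t :: real assume t: "0 \<le> t" "t \<le> 1"
    have "0 < (1 - t) + t * m"
      using t assms by (cases "t = 0") (auto intro: add_nonneg_pos)
    then have "1 + t * (m - 1) \<noteq> 0" by (simp add: algebra_simps)
    then show "homeomorphic_map euclidean euclidean (\<lambda>x. x + t *\<^sub>R (m - 1) *\<^sub>R (x - p))"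
      unfolding eq by (rule homeomorphic_map_homothety)
  qed
  then show ?thesis using eq[of _ 1] by simp
qed

text \<open>The radius enters only as the factor \<open>r\<^sup>2\<close> of a scaling about
  \<open>p\<close>, so the knot type depends on the centre alone.\<close>

lemma polygonal_inversion_radius_1:
  assumes r: "0 < r" and emb: "embedded_polygon (polygonal_inversion p r K)"
  shows "embedded_polygon (polygonal_inversion p 1 K)"
    and "ambient_isotopic (polygon (polygonal_inversion p r K)) (polygon (polygonal_inversion p 1 K))"
proof -
  let ?f = "\<lambda>x. p + (1 / r\<^sup>2) *\<^sub>R (x - p)"
  have f: "?f (inversion p r v) = inversion p 1 v" for v
    using r by (simp add: inversion_def)
  have n: "3 \<le> length K" using emb by (simp add: embedded_polygon_def polygonal_inversion_def)
  have s_lt: "Suc i mod length K < length K" for i using n by (intro mod_less_divisor) auto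
  have "embedded_polygon (polygonal_inversion p 1 K) \<and>
    ?f ` polygon (polygonal_inversion p r K) = polygon (polygonal_inversion p 1 K)"
  proof (rule embedded_polygon_image[OF emb])
    show "inj ?f" using r by (auto simp: inj_def)
    show "?f ` edge (polygonal_inversion p r K) i = edge (polygonal_inversion p 1 K) i"
      if "i < length (polygonal_inversion p r K)" for i
      using that s_lt unfolding edge_def closed_segment_homothety
      by (simp add: polygonal_inversion_def f del: scaleR_right_diff_distrib)
    show "?f (polygonal_inversion p r K ! i) = polygonal_inversion p 1 K ! i"
      if "i < length (polygonal_inversion p r K)" for i
      using that f by (simp add: polygonal_inversion_def)
  qed (simp add: polygonal_inversion_def)
  moreover have "ambient_isotopic (polygon (polygonal_inversion p r K)) (?f ` polygon (polygonal_inversion p r K))"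
    using r by (intro ambient_isotopic_homothety) simp
  ultimately show "embedded_polygon (polygonal_inversion p 1 K)"
    "ambient_isotopic (polygon (polygonal_inversion p r K)) (polygon (polygonal_inversion p 1 K))" by simp_all
qed

section \<open>Constancy on components and the count\<close>

lemma ambient_isotopic_on_connected:
  assumes "connected S" and "x \<in> S" "y \<in> S"
    and S: "\<And>q. q \<in> S \<Longrightarrow> q \<notin> set K \<and> embedded_polygon (polygonal_inversion q r K)"
  shows "ambient_isotopic (polygon (polygonal_inversion x r K)) (polygon (polygonal_inversion y r K))"
proof (rule connected_equivalence_relation[OF assms(1-3)])
  fix a assume "a \<in> S"
  then obtain \<epsilon> where "\<epsilon> > 0" and \<epsilon>: "\<forall>q\<in>ball a \<epsilon>. ambient_isotopic (polygon (polygonal_inversion a r K)) (polygon (polygonal_inversion q r K))"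
    using polygonal_inversion_stable S by blast
  then show "\<exists>T. openin (top_of_set S) T \<and> a \<in> T \<and>
      (\<forall>x\<in>T. ambient_isotopic (polygon (polygonal_inversion a r K)) (polygon (polygonal_inversion x r K)))"
    using \<open>a \<in> S\<close> by (intro exI[of _ "S \<inter> ball a \<epsilon>"]) auto
qed (use ambient_isotopic_sym ambient_isotopic_trans in blast)+

text \<open>It suffices to compare generic points locally, inside a ball around each point of
  \<open>C\<close>: generic points are dense, so the relation spreads over the connected set
  \<open>C\<close>.\<close>

lemma ambient_isotopic_in_component:
  assumes emb: "embedded_polygon K" and C: "open C" "connected C" "C \<inter> \<Union>(edge_pair_spheres K) = {}"
    and x: "x \<in> C" "x \<notin> vertex_circles K" and y: "y \<in> C" "y \<notin> vertex_circles K" and r: "0 < r"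
  shows "ambient_isotopic (polygon (polygonal_inversion x r K)) (polygon (polygonal_inversion y r K))"
proof -
  have n: "3 \<le> length K" "distinct K" using emb by (auto simp: embedded_polygon_def)
  have good: "q \<notin> set K \<and> embedded_polygon (polygonal_inversion q r K)"
    if "q \<in> C" "q \<notin> vertex_circles K" for q
    using that C(3) set_subset_vertex_circles[OF n(2,1)] embedded_polygon_inversion[OF emb r] by blast
  let ?R = "\<lambda>x y. ambient_isotopic (polygon (polygonal_inversion x r K)) (polygon (polygonal_inversion y r K))"
  show ?thesis
  proof (rule connected_equivalence_relation_gen[OF C(2), where P = "\<lambda>q. q \<notin> vertex_circles K" and R = ?R])
    show "\<exists>z. z \<in> T \<and> z \<notin> vertex_circles K" if T: "openin (top_of_set C) T" "a \<in> T" for T a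
    proof -
      have "open T" using T(1) C(1) openin_open_eq by blast
      then have "\<not> T \<subseteq> vertex_circles K"
        using T(2) open_not_negligible negligible_vertex_circles negligible_subset by (metis empty_iff)
      then show ?thesis by blast
    qed
    show "\<exists>T. openin (top_of_set C) T \<and> a \<in> T \<and>
        (\<forall>x\<in>T. \<forall>y\<in>T. x \<notin> vertex_circles K \<and> y \<notin> vertex_circles K \<longrightarrow> ?R x y)" if a: "a \<in> C" for a
    proof -
      obtain \<epsilon> where "\<epsilon> > 0" and B: "ball a \<epsilon> \<subseteq> C"
        using C(1) a open_contains_ball by blast
      have "?R x y" if xy: "x \<in> ball a \<epsilon>" "y \<in> ball a \<epsilon>" "x \<notin> vertex_circles K" "y \<notin> vertex_circles K" for x y
      proof (cases "x = y")
        case True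
        then show ?thesis using ambient_isotopic_refl by simp
      next
        case False
        then obtain c where c: "c \<in> ball a \<epsilon>" "\<not> collinear {x, y, c}"
          and fin: "finite (affine hull {x, y, c} \<inter> vertex_circles K)"
          using exists_plane_meeting_vertex_circles_finitely[of "ball a \<epsilon>" x K y] xy by auto
        let ?H = "convex hull {x, y, c}" and ?F = "affine hull {x, y, c} \<inter> vertex_circles K"
        have H: "{x, y, c} \<subseteq> ?H" by (rule hull_subset)
        \<comment> \<open>Noncollinearity makes the triangle two-dimensional, so it survives the
          removal of finitely many points; a segment from \<open>x\<close> to \<open>y\<close> would
          not.\<close>
        have "connected (?H - ?F)"
        proof (rule connected_convex_diff_countable)
          show "\<not> collinear ?H" using c(2) H collinear_subset by blast
        qed (use fin countable_finite in auto)
        moreover have "?H \<subseteq> ball a \<epsilon>"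
          using xy c(1) by (intro hull_minimal) auto
        moreover have "?H - ?F = ?H - vertex_circles K"
          using convex_hull_subset_affine_hull by blast
        ultimately show ?thesis
          using H xy B good by (intro ambient_isotopic_on_connected[of "?H - vertex_circles K"]) auto
      qed
      then show ?thesis
        using \<open>\<epsilon> > 0\<close> B C(1) by (intro exI[of _ "ball a \<epsilon>"]) (auto simp: openin_open_eq)
    qed
    show "?R x z" if "?R x y" "?R y z" for x y z
      using that by (rule ambient_isotopic_trans)
  qed fact+
qed

text \<open>Stability gives a ball of centres with the same knot type, and the nongeneric centres
  are negligible. The ball may reach into several components; any of them will do, since one
  representative per knot type is enough.\<close>

lemma inversion_knot_type_representative:
  assumes emb: "embedded_polygon K" and \<tau>: "\<tau> \<in> inversion_knot_types K"
  obtains p where "p \<notin> \<Union>(edge_pair_spheres K)" "p \<notin> vertex_circles K"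
    "\<tau> = knot_type (polygon (polygonal_inversion p 1 K))"
proof -
  obtain p r where r: "0 < r" and p: "p \<notin> set K" "embedded_polygon (polygonal_inversion p r K)"
    and \<tau>p: "\<tau> = knot_type (polygon (polygonal_inversion p r K))"
    using \<tau> unfolding inversion_knot_types_def by blast
  note p1 = polygonal_inversion_radius_1[OF r p(2)]
  obtain \<epsilon> where "\<epsilon> > 0" and \<epsilon>: "\<And>q. q \<in> ball p \<epsilon> \<Longrightarrow>
      ambient_isotopic (polygon (polygonal_inversion p 1 K)) (polygon (polygonal_inversion q 1 K))"
    using polygonal_inversion_stable[OF p(1) p1(1)] by blast
  have "negligible (\<Union>(edge_pair_spheres K) \<union> vertex_circles K)"
    using edge_pair_spheres_bound(1) negligible_vertex_circles emb negligible_spheres_and_planes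
    by (intro negligible_Un negligible_Union) (auto simp: embedded_polygon_def edge_pair_spheres_def)
  then have "\<not> ball p \<epsilon> \<subseteq> \<Union>(edge_pair_spheres K) \<union> vertex_circles K"
    using open_not_negligible[of "ball p \<epsilon>"] negligible_subset \<open>\<epsilon> > 0\<close>
    by (metis ball_eq_empty not_le open_ball)
  then obtain q where q: "q \<in> ball p \<epsilon>" "q \<notin> \<Union>(edge_pair_spheres K)" "q \<notin> vertex_circles K" by blast
  have "\<tau> = knot_type (polygon (polygonal_inversion q 1 K))"
    unfolding \<tau>p knot_type_eq_iff using p1(2) \<epsilon>[OF q(1)] by (rule ambient_isotopic_trans)
  with q show thesis using that by blast
qed

lemma closed_spheres_and_planes: "T \<in> spheres_and_planes \<Longrightarrow> closed T"
  by (auto simp: spheres_and_planes_def closed_hyperplane)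

theorem theorem2:
  fixes K :: "(real^3) list" and n :: nat
  assumes "embedded_polygon K" and "length K = n"
  shows "inversion_knot_types K \<lesssim> components (- \<Union>(edge_pair_spheres K))
    \<and> finite (edge_pair_spheres K)
    \<and> real (card (edge_pair_spheres K)) \<le> real n * (real n - 3) / 2"
proof (intro conjI)
  note emb = assms(1)
  have "3 \<le> length K" using emb by (simp add: embedded_polygon_def)
  note bound = edge_pair_spheres_bound[OF this]
  show "finite (edge_pair_spheres K)" by (rule bound(1))
  show "real (card (edge_pair_spheres K)) \<le> real n * (real n - 3) / 2"
    using bound(2) assms(2) by simp
  let ?U = "- \<Union>(edge_pair_spheres K)"
  have "open ?U"
    using bound(1) closed_spheres_and_planes
    by (intro open_Compl closed_Union) (auto simp: edge_pair_spheres_def)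
  have "\<forall>\<tau>\<in>inversion_knot_types K. \<exists>p. p \<in> ?U \<and> p \<notin> vertex_circles K \<and>
      \<tau> = knot_type (polygon (polygonal_inversion p 1 K))"
    using inversion_knot_type_representative[OF emb] by (metis ComplI)
  then obtain p where p: "\<And>\<tau>. \<tau> \<in> inversion_knot_types K \<Longrightarrow> p \<tau> \<in> ?U \<and> p \<tau> \<notin> vertex_circles K \<and>
      \<tau> = knot_type (polygon (polygonal_inversion (p \<tau>) 1 K))" by metis
  define f where "f \<tau> = connected_component_set ?U (p \<tau>)" for \<tau>
  have "inj_on f (inversion_knot_types K)"
  proof (rule inj_onI)
    fix \<sigma> \<tau> assume \<sigma>: "\<sigma> \<in> inversion_knot_types K" and \<tau>: "\<tau> \<in> inversion_knot_types K" and eq: "f \<sigma> = f \<tau>"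
    have "p \<sigma> \<in> f \<sigma>" "p \<tau> \<in> f \<tau>"
      using p[OF \<sigma>] p[OF \<tau>] by (simp_all add: f_def)
    then have "p \<sigma> \<in> f \<sigma>" "p \<tau> \<in> f \<sigma>"
      by (simp_all add: eq)
    moreover have "open (f \<sigma>)" "connected (f \<sigma>)" "f \<sigma> \<inter> \<Union>(edge_pair_spheres K) = {}"
      using \<open>open ?U\<close> connected_component_subset[of ?U "p \<sigma>"] by (auto simp: f_def open_connected_component)
    ultimately have "ambient_isotopic (polygon (polygonal_inversion (p \<sigma>) 1 K)) (polygon (polygonal_inversion (p \<tau>) 1 K))"
      using p[OF \<sigma>] p[OF \<tau>] by (intro ambient_isotopic_in_component[OF emb, of "f \<sigma>"]) auto
    then show "\<sigma> = \<tau>"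
      using p[OF \<sigma>] p[OF \<tau>] knot_type_eq_iff by metis
  qed
  moreover have "f ` inversion_knot_types K \<subseteq> components ?U"
    using p by (auto simp: f_def components_def)
  ultimately show "inversion_knot_types K \<lesssim> components ?U"
    unfolding lepoll_def by blast
qed

end
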